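(* Let $R$ be an almost local-global semihereditary ring. Then: (1) $R$ is an almost Bézout ring. (2) For every pair of invertible ideals $I, J$ of $R$, $I/JI\cong R/J$ (as $R$-modules).
   Context: All rings are commutative with identity. A ring is semihereditary if every finitely generated ideal is projective, and Bézout if every finitely generated ideal is principal. An ideal is faithful if its annihilator is $0$; an ideal is invertible if it is invertible as a fractional ideal in the total ring of fractions. A ring $R$ is local-global if each polynomial $f$ over $R$ in finitely many indeterminates which admits unit values locally (i.e. for every maximal ideal $P$, $f$ takes a unit value over $R_P$) admits unit values over $R$. A ring $R$ is almost local-global if for every faithful principal ideal $I$ of $R$, the ring $R/I$ is local-global. A ring $R$ is almost Bézout if for each faithful principal ideal $A$ of $R$, the ring $R/A$ is Bézout. *)

theory Defs
  imports "HOL-Algebra.Algebra"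
begin

section \<open>Localisation\<close>

text \<open>
  For a multiplicative subset \<open>S\<close> of a commutative ring \<open>R\<close>, the ring \<open>S\<^sup>-\<^sup>1R\<close> is realised on the
  equivalence classes of pairs \<open>(a, s)\<close>, with the usual extra factor \<open>u\<close> that is needed in the
  presence of zero divisors.
\<close>

definition frac_rel :: "('a, 'm) ring_scheme \<Rightarrow> 'a set \<Rightarrow> (('a \<times> 'a) \<times> ('a \<times> 'a)) set" where
  "frac_rel R S =
    {((a, s), (b, t)) | a s b t. a \<in> carrier R \<and> s \<in> S \<and> b \<in> carrier R \<and> t \<in> S \<and>
       (\<exists>u\<in>S. u \<otimes>\<^bsub>R\<^esub> (a \<otimes>\<^bsub>R\<^esub> t) = u \<otimes>\<^bsub>R\<^esub> (b \<otimes>\<^bsub>R\<^esub> s))}"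

definition frac :: "('a, 'm) ring_scheme \<Rightarrow> 'a set \<Rightarrow> 'a \<Rightarrow> 'a \<Rightarrow> ('a \<times> 'a) set" where
  "frac R S a s = frac_rel R S `` {(a, s)}"

definition localization :: "('a, 'm) ring_scheme \<Rightarrow> 'a set \<Rightarrow> (('a \<times> 'a) set) ring" where
  "localization R S =
    \<lparr>carrier = (carrier R \<times> S) // frac_rel R S,
     monoid.mult = (\<lambda>U V. \<Union>p\<in>U. \<Union>q\<in>V. frac R S (fst p \<otimes>\<^bsub>R\<^esub> fst q) (snd p \<otimes>\<^bsub>R\<^esub> snd q)),
     monoid.one = frac R S \<one>\<^bsub>R\<^esub> \<one>\<^bsub>R\<^esub>,
     ring.zero = frac R S \<zero>\<^bsub>R\<^esub> \<one>\<^bsub>R\<^esub>,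
     ring.add = (\<lambda>U V. \<Union>p\<in>U. \<Union>q\<in>V.
                  frac R S ((fst p \<otimes>\<^bsub>R\<^esub> snd q) \<oplus>\<^bsub>R\<^esub> (fst q \<otimes>\<^bsub>R\<^esub> snd p))
                    (snd p \<otimes>\<^bsub>R\<^esub> snd q))\<rparr>"

definition loc_map :: "('a, 'm) ring_scheme \<Rightarrow> 'a set \<Rightarrow> 'a \<Rightarrow> ('a \<times> 'a) set" where
  "loc_map R S r = frac R S r \<one>\<^bsub>R\<^esub>"


section \<open>Local-global rings\<close>

text \<open>
  The value at the point \<open>x \<in> S\<^sup>n\<close> of the image under \<open>h : R \<rightarrow> S\<close> of a polynomial \<open>f\<close> over \<open>R\<close> in
  the indeterminates \<open>0, \<dots>, n - 1\<close>; a polynomial is a function from monomials (multisets of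
  indeterminates) to coefficients.
\<close>

definition mpoly_value ::
  "('a, 'm) ring_scheme \<Rightarrow> ('b, 'n) ring_scheme \<Rightarrow> ('a \<Rightarrow> 'b) \<Rightarrow> nat \<Rightarrow>
    (nat multiset \<Rightarrow> 'a) \<Rightarrow> (nat \<Rightarrow> 'b) \<Rightarrow> 'b" where
  "mpoly_value R S h n f x =
    (\<Oplus>\<^bsub>S\<^esub>m\<in>{m. f m \<noteq> \<zero>\<^bsub>R\<^esub>}. h (f m) \<otimes>\<^bsub>S\<^esub> (\<Otimes>\<^bsub>S\<^esub>i\<in>{..<n}. x i [^]\<^bsub>S\<^esub> count m i))"

definition admits_unit_value ::
  "('a, 'm) ring_scheme \<Rightarrow> ('b, 'n) ring_scheme \<Rightarrow> ('a \<Rightarrow> 'b) \<Rightarrow> nat \<Rightarrow>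
    (nat multiset \<Rightarrow> 'a) \<Rightarrow> bool" where
  "admits_unit_value R S h n f \<longleftrightarrow>
    (\<exists>x \<in> {..<n} \<rightarrow> carrier S. mpoly_value R S h n f x \<in> Units S)"

definition local_global :: "('a, 'm) ring_scheme \<Rightarrow> bool" where
  "local_global R \<longleftrightarrow>
    (\<forall>n. \<forall>f \<in> ring.indexed_pset R {..<n} (carrier R).
       (\<forall>P. maximalideal P R \<longrightarrow>
          admits_unit_value R (localization R (carrier R - P)) (loc_map R (carrier R - P)) n f) \<longrightarrow>
       admits_unit_value R R id n f)"

definition annihilator :: "('a, 'm) ring_scheme \<Rightarrow> 'a set \<Rightarrow> 'a set" where
  "annihilator R I = {r \<in> carrier R. \<forall>x\<in>I. r \<otimes>\<^bsub>R\<^esub> x = \<zero>\<^bsub>R\<^esub>}"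

definition faithful :: "('a, 'm) ring_scheme \<Rightarrow> 'a set \<Rightarrow> bool" where
  "faithful R I \<longleftrightarrow> annihilator R I = {\<zero>\<^bsub>R\<^esub>}"

definition almost_local_global :: "('a, 'm) ring_scheme \<Rightarrow> bool" where
  "almost_local_global R \<longleftrightarrow>
    (\<forall>I. principalideal I R \<longrightarrow> faithful R I \<longrightarrow> local_global (R Quot I))"


section \<open>Bezout rings\<close>

definition fg_ideal :: "('a, 'm) ring_scheme \<Rightarrow> 'a set \<Rightarrow> bool" where
  "fg_ideal R I \<longleftrightarrow> (\<exists>A. finite A \<and> A \<subseteq> carrier R \<and> I = Idl\<^bsub>R\<^esub> A)"

definition bezout :: "('a, 'm) ring_scheme \<Rightarrow> bool" where
  "bezout R \<longleftrightarrow> (\<forall>I. fg_ideal R I \<longrightarrow> principalideal I R)"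

definition almost_bezout :: "('a, 'm) ring_scheme \<Rightarrow> bool" where
  "almost_bezout R \<longleftrightarrow>
    (\<forall>A. principalideal A R \<longrightarrow> faithful R A \<longrightarrow> bezout (R Quot A))"


section \<open>Modules\<close>

text \<open>
  The record type of modules extends that of rings, but the locale \<^locale>\<open>module\<close> does not
  constrain the fields \<open>mult\<close> and \<open>one\<close>; they are left unspecified in the modules below.
\<close>

definition ring_module :: "('a, 'm) ring_scheme \<Rightarrow> ('a, 'a) module" where
  "ring_module R =
    \<lparr>carrier = carrier R, monoid.mult = undefined, monoid.one = undefined, ring.zero = \<zero>\<^bsub>R\<^esub>,
     ring.add = ring.add R, smult = monoid.mult R\<rparr>"

definition ideal_module :: "('a, 'm) ring_scheme \<Rightarrow> 'a set \<Rightarrow> ('a, 'a) module" where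
  "ideal_module R I = (ring_module R)\<lparr>carrier := I\<rparr>"

definition quot_module :: "('a, 'b, 'm) module_scheme \<Rightarrow> 'b set \<Rightarrow> ('a, 'b set) module" where
  "quot_module M N =
    \<lparr>carrier = a_rcosets\<^bsub>M\<^esub> N, monoid.mult = undefined, monoid.one = undefined, ring.zero = N,
     ring.add = set_add M, smult = (\<lambda>r U. \<Union>x\<in>U. N +>\<^bsub>M\<^esub> (r \<odot>\<^bsub>M\<^esub> x))\<rparr>"

definition mod_hom ::
  "('a, 'm) ring_scheme \<Rightarrow> ('a, 'b, 'p) module_scheme \<Rightarrow> ('a, 'c, 'q) module_scheme \<Rightarrow>
    ('b \<Rightarrow> 'c) set" where
  "mod_hom R M N =
    {h \<in> carrier M \<rightarrow> carrier N.
       (\<forall>x\<in>carrier M. \<forall>y\<in>carrier M. h (x \<oplus>\<^bsub>M\<^esub> y) = h x \<oplus>\<^bsub>N\<^esub> h y) \<and>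
       (\<forall>r\<in>carrier R. \<forall>x\<in>carrier M. h (r \<odot>\<^bsub>M\<^esub> x) = r \<odot>\<^bsub>N\<^esub> h x)}"

definition mod_isomorphic ::
  "('a, 'm) ring_scheme \<Rightarrow> ('a, 'b, 'p) module_scheme \<Rightarrow> ('a, 'c, 'q) module_scheme \<Rightarrow> bool" where
  "mod_isomorphic R M N \<longleftrightarrow> (\<exists>h\<in>mod_hom R M N. bij_betw h (carrier M) (carrier N))"

definition free_module :: "('a, 'm) ring_scheme \<Rightarrow> 'i set \<Rightarrow> ('a, 'i \<Rightarrow> 'a) module" where
  "free_module R B =
    \<lparr>carrier = {f. (\<forall>i\<in>B. f i \<in> carrier R) \<and> (\<forall>i. i \<notin> B \<longrightarrow> f i = \<zero>\<^bsub>R\<^esub>) \<and>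
                   finite {i. f i \<noteq> \<zero>\<^bsub>R\<^esub>}},
     monoid.mult = undefined, monoid.one = undefined, ring.zero = (\<lambda>_. \<zero>\<^bsub>R\<^esub>),
     ring.add = (\<lambda>f g i. f i \<oplus>\<^bsub>R\<^esub> g i), smult = (\<lambda>r f i. r \<otimes>\<^bsub>R\<^esub> f i)\<rparr>"

text \<open>
  A module is projective if it is isomorphic to a direct summand of a free module. It is enough to
  let the basis range over subsets of the type of the elements of \<open>M\<close>: if \<open>M\<close> is a direct summand
  of some free module, then the canonical surjection onto \<open>M\<close> from the free module with basis
  \<open>carrier M\<close> splits.
\<close>

definition projective_module ::
  "('a, 'm) ring_scheme \<Rightarrow> ('a, 'b, 'p) module_scheme \<Rightarrow> bool" where
  "projective_module R M \<longleftrightarrow>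
    (\<exists>(B :: 'b set) K L.
       submodule K R (free_module R B) \<and> submodule L R (free_module R B) \<and>
       K \<inter> L = {\<zero>\<^bsub>free_module R B\<^esub>} \<and>
       K <+>\<^bsub>free_module R B\<^esub> L = carrier (free_module R B) \<and>
       mod_isomorphic R M ((free_module R B)\<lparr>carrier := K\<rparr>))"

definition semihereditary :: "('a, 'm) ring_scheme \<Rightarrow> bool" where
  "semihereditary R \<longleftrightarrow> (\<forall>I. fg_ideal R I \<longrightarrow> projective_module R (ideal_module R I))"


section \<open>Fractional and invertible ideals\<close>

definition regular_elements :: "('a, 'm) ring_scheme \<Rightarrow> 'a set" where
  "regular_elements R =
    {r \<in> carrier R. \<forall>x\<in>carrier R. r \<otimes>\<^bsub>R\<^esub> x = \<zero>\<^bsub>R\<^esub> \<longrightarrow> x = \<zero>\<^bsub>R\<^esub>}"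

definition total_fractions :: "('a, 'm) ring_scheme \<Rightarrow> (('a \<times> 'a) set) ring" where
  "total_fractions R = localization R (regular_elements R)"

definition total_map :: "('a, 'm) ring_scheme \<Rightarrow> 'a \<Rightarrow> ('a \<times> 'a) set" where
  "total_map R = loc_map R (regular_elements R)"

definition total_fractions_module :: "('a, 'm) ring_scheme \<Rightarrow> ('a, ('a \<times> 'a) set) module" where
  "total_fractions_module R =
    \<lparr>carrier = carrier (total_fractions R), monoid.mult = undefined, monoid.one = undefined,
     ring.zero = \<zero>\<^bsub>total_fractions R\<^esub>, ring.add = ring.add (total_fractions R),
     smult = (\<lambda>r x. total_map R r \<otimes>\<^bsub>total_fractions R\<^esub> x)\<rparr>"

definition fractional_ideal :: "('a, 'm) ring_scheme \<Rightarrow> ('a \<times> 'a) set set \<Rightarrow> bool" where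
  "fractional_ideal R B \<longleftrightarrow>
    submodule B R (total_fractions_module R) \<and>
    (\<exists>d\<in>regular_elements R. \<forall>b\<in>B.
       total_map R d \<otimes>\<^bsub>total_fractions R\<^esub> b \<in> total_map R ` carrier R)"

text \<open>
  The identity for multiplication of fractional ideals is the image of \<open>R\<close>. The set
  \<^const>\<open>ideal_prod\<close> consists of the finite sums of products and so is also the product of
  fractional ideals.
\<close>

definition invertible_ideal :: "('a, 'm) ring_scheme \<Rightarrow> 'a set \<Rightarrow> bool" where
  "invertible_ideal R I \<longleftrightarrow>
    ideal I R \<and>
    (\<exists>B. fractional_ideal R B \<and>
       (total_map R ` I) \<cdot>\<^bsub>total_fractions R\<^esub> B = total_map R ` carrier R)"

end

theory Submission
  imports Defs
begin

text \<open>
  Let \<open>I\<close> be an ideal and \<open>d\<close> a regular element of the product \<open>I \<cdot> (dR : I)\<close>; such a \<open>d\<close> exists if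
  \<open>I\<close> is invertible, and by the dual basis lemma every regular element of a projective ideal is one.
  Write \<open>d = \<Sum> x\<^sub>i y\<^sub>i\<close> and \<open>x\<^sub>i y\<^sub>j = d c\<^sub>i\<^sub>j\<close>. The form \<open>\<Sum> c\<^sub>i\<^sub>j X\<^sub>i Y\<^sub>j\<close> has a unit value over every
  local ring since \<open>\<Sum> c\<^sub>i\<^sub>i = 1\<close>, so for every regular \<open>s\<close> it has a value \<open>w\<close> that is a unit modulo \<open>s\<close>.
  This gives \<open>x \<in> I\<close> and \<open>y \<in> (dR : I)\<close> with \<open>x y = d w\<close>. Multiplication by \<open>y / d\<close> maps \<open>I\<close> into
  \<open>R\<close> and \<open>x\<close> to \<open>w\<close>; hence \<open>I = x R + s I\<close>. With \<open>s = d \<in> I\<close> this is (1), and with a regular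
  \<open>s \<in> J\<close> multiplication by \<open>y / d\<close> induces the isomorphism in (2).
\<close>

section \<open>Rings of fractions\<close>

text \<open>Two instances occur: the complement of a prime ideal, for values over local rings, and
  the set of regular elements, for the total ring of fractions.\<close>

locale mult_subset = cring R + submonoid S R for R (structure) and S
begin

lemma S_carrier [simp, intro]: "s \<in> S \<Longrightarrow> s \<in> carrier R"
  using subset by blast

lemma frac_rel_iff:
  "((a, s), (b, t)) \<in> frac_rel R S \<longleftrightarrow> a \<in> carrier R \<and> s \<in> S \<and> b \<in> carrier R \<and> t \<in> S \<and>
     (\<exists>u\<in>S. u \<otimes> (a \<otimes> t) = u \<otimes> (b \<otimes> s))"
  unfolding frac_rel_def by auto

text \<open>If \<open>u\<close> and \<open>v\<close> witness the two given relations, then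
  \<open>u \<otimes> v \<otimes> t\<close> witnesses the composite. The middle denominator
  \<open>t\<close> has to be a factor, since it occurs in both of the equations that are
  substituted.\<close>

lemma frac_rel_trans:
  assumes "((a, s), (b, t)) \<in> frac_rel R S" "((b, t), (c, r)) \<in> frac_rel R S"
  shows "((a, s), (c, r)) \<in> frac_rel R S"
proof -
  from assms obtain u v where u: "u \<in> S" "u \<otimes> (a \<otimes> t) = u \<otimes> (b \<otimes> s)"
    and v: "v \<in> S" "v \<otimes> (b \<otimes> r) = v \<otimes> (c \<otimes> t)"
    and mem: "a \<in> carrier R" "b \<in> carrier R" "c \<in> carrier R" "s \<in> S" "t \<in> S" "r \<in> S"
    unfolding frac_rel_iff by blast
  have "(u \<otimes> v \<otimes> t) \<otimes> (a \<otimes> r) = (u \<otimes> (a \<otimes> t)) \<otimes> (v \<otimes> r)"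
    using u(1) v(1) mem by (simp add: m_ac)
  also have "\<dots> = (v \<otimes> (b \<otimes> r)) \<otimes> (u \<otimes> s)"
    unfolding u(2) using u(1) v(1) mem by (simp add: m_ac)
  also have "\<dots> = (u \<otimes> v \<otimes> t) \<otimes> (c \<otimes> s)"
    unfolding v(2) using u(1) v(1) mem by (simp add: m_ac)
  finally show ?thesis
    unfolding frac_rel_iff using mem u(1) v(1) by (blast intro: m_closed)
qed

lemma equiv_frac_rel: "equiv (carrier R \<times> S) (frac_rel R S)"
proof (rule equivI)
  show "frac_rel R S \<subseteq> (carrier R \<times> S) \<times> (carrier R \<times> S)"
    unfolding frac_rel_def by auto
  show "refl_on (carrier R \<times> S) (frac_rel R S)"
    by (rule refl_onI) (auto simp: frac_rel_iff)
  show "sym (frac_rel R S)"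
    by (rule symI) (auto simp: frac_rel_iff, metis)
  show "trans (frac_rel R S)"
    by (rule transI) (use frac_rel_trans in auto)
qed

lemma frac_eq_iff:
  assumes "a \<in> carrier R" "s \<in> S" "b \<in> carrier R" "t \<in> S"
  shows "frac R S a s = frac R S b t \<longleftrightarrow> (\<exists>u\<in>S. u \<otimes> (a \<otimes> t) = u \<otimes> (b \<otimes> s))"
proof -
  have "frac R S a s = frac R S b t \<longleftrightarrow> ((a, s), (b, t)) \<in> frac_rel R S"
    unfolding frac_def using eq_equiv_class_iff[OF equiv_frac_rel] assms by blast
  then show ?thesis
    using assms by (simp add: frac_rel_iff)
qed

lemma frac_eqI:
  assumes "a \<otimes> t = b \<otimes> s" "a \<in> carrier R" "s \<in> S" "b \<in> carrier R" "t \<in> S"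
  shows "frac R S a s = frac R S b t"
  using assms by (auto simp: frac_eq_iff)

lemma frac_carrier [simp, intro]:
  "a \<in> carrier R \<Longrightarrow> s \<in> S \<Longrightarrow> frac R S a s \<in> carrier (localization R S)"
  unfolding localization_def frac_def by (simp add: quotientI)

lemma localization_cases:
  assumes "x \<in> carrier (localization R S)"
  obtains a s where "a \<in> carrier R" "s \<in> S" "x = frac R S a s"
  using assms unfolding localization_def frac_def by (auto elim: quotientE)

text \<open>Each union in the definition of the operations is a union of copies of one class.\<close>

lemma frac_Union:
  assumes mem: "a \<in> carrier R" "s \<in> S" "b \<in> carrier R" "t \<in> S"
    and const: "\<And>p q. ((a, s), p) \<in> frac_rel R S \<Longrightarrow> ((b, t), q) \<in> frac_rel R S \<Longrightarrow> F p q = C"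
  shows "(\<Union>p\<in>frac R S a s. \<Union>q\<in>frac R S b t. F p q) = C"
proof -
  have "(a, s) \<in> frac R S a s" "(b, t) \<in> frac R S b t"
    using mem by (auto simp: frac_def frac_rel_iff)
  moreover have "F p q = C" if "p \<in> frac R S a s" "q \<in> frac R S b t" for p q
    using that const by (simp add: frac_def)
  ultimately show ?thesis by blast
qed

lemma frac_mult:
  assumes mem: "a \<in> carrier R" "s \<in> S" "b \<in> carrier R" "t \<in> S"
  shows "frac R S a s \<otimes>\<^bsub>localization R S\<^esub> frac R S b t = frac R S (a \<otimes> b) (s \<otimes> t)"
  unfolding localization_def monoid.simps
proof (rule frac_Union[OF mem])
  fix p q assume rel: "((a, s), p) \<in> frac_rel R S" "((b, t), q) \<in> frac_rel R S"
  obtain a' s' b' t' where pq: "p = (a', s')" "q = (b', t')"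
    by (metis surj_pair)
  from rel obtain u v where u: "u \<in> S" "u \<otimes> (a \<otimes> s') = u \<otimes> (a' \<otimes> s)"
    and v: "v \<in> S" "v \<otimes> (b \<otimes> t') = v \<otimes> (b' \<otimes> t)"
    and mem': "a' \<in> carrier R" "b' \<in> carrier R" "s' \<in> S" "t' \<in> S"
    unfolding pq frac_rel_iff by blast
  have "(u \<otimes> v) \<otimes> ((a' \<otimes> b') \<otimes> (s \<otimes> t)) = (u \<otimes> (a' \<otimes> s)) \<otimes> (v \<otimes> (b' \<otimes> t))"
    using u(1) v(1) mem mem' by (simp add: m_ac)
  also have "\<dots> = (u \<otimes> v) \<otimes> ((a \<otimes> b) \<otimes> (s' \<otimes> t'))"
    unfolding u(2)[symmetric] v(2)[symmetric] using u(1) v(1) mem mem' by (simp add: m_ac)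
  finally have "\<exists>w\<in>S. w \<otimes> ((a' \<otimes> b') \<otimes> (s \<otimes> t)) = w \<otimes> ((a \<otimes> b) \<otimes> (s' \<otimes> t'))"
    using u(1) v(1) by blast
  then show "frac R S (fst p \<otimes> fst q) (snd p \<otimes> snd q) = frac R S (a \<otimes> b) (s \<otimes> t)"
    using mem mem' by (simp add: pq frac_eq_iff)
qed

lemma frac_add:
  assumes mem: "a \<in> carrier R" "s \<in> S" "b \<in> carrier R" "t \<in> S"
  shows "frac R S a s \<oplus>\<^bsub>localization R S\<^esub> frac R S b t =
    frac R S (a \<otimes> t \<oplus> b \<otimes> s) (s \<otimes> t)"
  unfolding localization_def ring.simps
proof (rule frac_Union[OF mem])
  fix p q assume rel: "((a, s), p) \<in> frac_rel R S" "((b, t), q) \<in> frac_rel R S"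
  obtain a' s' b' t' where pq: "p = (a', s')" "q = (b', t')"
    by (metis surj_pair)
  from rel obtain u v where u: "u \<in> S" "u \<otimes> (a \<otimes> s') = u \<otimes> (a' \<otimes> s)"
    and v: "v \<in> S" "v \<otimes> (b \<otimes> t') = v \<otimes> (b' \<otimes> t)"
    and mem': "a' \<in> carrier R" "b' \<in> carrier R" "s' \<in> S" "t' \<in> S"
    unfolding pq frac_rel_iff by blast
  \<comment> \<open>After expansion each summand contains one of the two cross products, so the
    equations for \<open>u\<close> and \<open>v\<close> can be applied separately.\<close>
  have "(u \<otimes> v) \<otimes> ((a' \<otimes> t' \<oplus> b' \<otimes> s') \<otimes> (s \<otimes> t)) =
      (u \<otimes> (a' \<otimes> s)) \<otimes> (v \<otimes> (t \<otimes> t')) \<oplus> (v \<otimes> (b' \<otimes> t)) \<otimes> (u \<otimes> (s \<otimes> s'))"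
    using u(1) v(1) mem mem' by (simp add: m_ac l_distr r_distr)
  also have "\<dots> = (u \<otimes> v) \<otimes> ((a \<otimes> t \<oplus> b \<otimes> s) \<otimes> (s' \<otimes> t'))"
    unfolding u(2)[symmetric] v(2)[symmetric] using u(1) v(1) mem mem'
    by (simp add: m_ac l_distr r_distr)
  finally have "\<exists>w\<in>S. w \<otimes> ((a' \<otimes> t' \<oplus> b' \<otimes> s') \<otimes> (s \<otimes> t)) = w \<otimes> ((a \<otimes> t \<oplus> b \<otimes> s) \<otimes> (s' \<otimes> t'))"
    using u(1) v(1) by blast
  then show "frac R S (fst p \<otimes> snd q \<oplus> fst q \<otimes> snd p) (snd p \<otimes> snd q) =
      frac R S (a \<otimes> t \<oplus> b \<otimes> s) (s \<otimes> t)"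
    using mem mem' by (simp add: pq frac_eq_iff)
qed

lemma localization_one: "\<one>\<^bsub>localization R S\<^esub> = frac R S \<one> \<one>"
  and localization_zero: "\<zero>\<^bsub>localization R S\<^esub> = frac R S \<zero> \<one>"
  by (simp_all add: localization_def)

section \<open>The ring axioms for the localisation\<close>

lemma abelian_group_localization: "abelian_group (localization R S)" (is "abelian_group ?L")
proof (rule abelian_groupI)
  fix x y z assume "x \<in> carrier ?L" "y \<in> carrier ?L" "z \<in> carrier ?L"
  then obtain a s b t c r where mem: "a \<in> carrier R" "s \<in> S" "b \<in> carrier R" "t \<in> S"
      "c \<in> carrier R" "r \<in> S" and eq: "x = frac R S a s" "y = frac R S b t" "z = frac R S c r"
    by (metis localization_cases)
  have "(a \<otimes> t \<oplus> b \<otimes> s) \<otimes> r \<oplus> c \<otimes> (s \<otimes> t) = a \<otimes> (t \<otimes> r) \<oplus> (b \<otimes> r \<oplus> c \<otimes> t) \<otimes> s"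
    using mem by (simp add: l_distr r_distr m_ac a_ac)
  then show "x \<oplus>\<^bsub>?L\<^esub> y \<oplus>\<^bsub>?L\<^esub> z = x \<oplus>\<^bsub>?L\<^esub> (y \<oplus>\<^bsub>?L\<^esub> z)"
    using mem unfolding eq by (simp add: frac_add m_assoc)
next
  fix x y assume "x \<in> carrier ?L" "y \<in> carrier ?L"
  then obtain a s b t where mem: "a \<in> carrier R" "s \<in> S" "b \<in> carrier R" "t \<in> S"
    and eq: "x = frac R S a s" "y = frac R S b t"
    by (metis localization_cases)
  from mem show "x \<oplus>\<^bsub>?L\<^esub> y \<in> carrier ?L" "x \<oplus>\<^bsub>?L\<^esub> y = y \<oplus>\<^bsub>?L\<^esub> x"
    unfolding eq by (simp_all add: frac_add m_comm a_comm)
next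
  fix x assume "x \<in> carrier ?L"
  then obtain a s where x: "a \<in> carrier R" "s \<in> S" "x = frac R S a s"
    by (rule localization_cases)
  show "\<zero>\<^bsub>?L\<^esub> \<oplus>\<^bsub>?L\<^esub> x = x"
    unfolding x(3) localization_zero using x(1,2) by (simp add: frac_add)
  have "frac R S (\<ominus> a \<otimes> s \<oplus> a \<otimes> s) (s \<otimes> s) = frac R S \<zero> \<one>"
    by (rule frac_eqI) (use x(1,2) in \<open>simp_all add: l_minus l_neg\<close>)
  then have "frac R S (\<ominus> a) s \<oplus>\<^bsub>?L\<^esub> x = \<zero>\<^bsub>?L\<^esub>"
    unfolding x(3) localization_zero using x(1,2) by (simp add: frac_add)
  then show "\<exists>y\<in>carrier ?L. y \<oplus>\<^bsub>?L\<^esub> x = \<zero>\<^bsub>?L\<^esub>"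
    using x(1,2) by (intro bexI[of _ "frac R S (\<ominus> a) s"]) auto
qed (simp add: localization_zero)

lemma comm_monoid_localization: "comm_monoid (localization R S)" (is "comm_monoid ?L")
proof (rule comm_monoidI)
  fix x y z assume "x \<in> carrier ?L" "y \<in> carrier ?L" "z \<in> carrier ?L"
  then obtain a s b t c r where mem: "a \<in> carrier R" "s \<in> S" "b \<in> carrier R" "t \<in> S"
      "c \<in> carrier R" "r \<in> S" and eq: "x = frac R S a s" "y = frac R S b t" "z = frac R S c r"
    by (metis localization_cases)
  then show "x \<otimes>\<^bsub>?L\<^esub> y \<otimes>\<^bsub>?L\<^esub> z = x \<otimes>\<^bsub>?L\<^esub> (y \<otimes>\<^bsub>?L\<^esub> z)"
    unfolding eq using mem by (simp add: frac_mult m_assoc)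
next
  fix x y assume "x \<in> carrier ?L" "y \<in> carrier ?L"
  then obtain a s b t where mem: "a \<in> carrier R" "s \<in> S" "b \<in> carrier R" "t \<in> S"
    and eq: "x = frac R S a s" "y = frac R S b t"
    by (metis localization_cases)
  from mem show "x \<otimes>\<^bsub>?L\<^esub> y \<in> carrier ?L" "x \<otimes>\<^bsub>?L\<^esub> y = y \<otimes>\<^bsub>?L\<^esub> x"
    unfolding eq by (simp_all add: frac_mult m_comm)
next
  fix x assume "x \<in> carrier ?L"
  then obtain a s where x: "a \<in> carrier R" "s \<in> S" "x = frac R S a s"
    by (rule localization_cases)
  show "\<one>\<^bsub>?L\<^esub> \<otimes>\<^bsub>?L\<^esub> x = x"
    unfolding x(3) localization_one using x(1,2) by (simp add: frac_mult)
qed (simp add: localization_one)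

lemma cring_localization: "cring (localization R S)" (is "cring ?L")
proof (rule cringI[OF abelian_group_localization comm_monoid_localization])
  fix x y z assume "x \<in> carrier ?L" "y \<in> carrier ?L" "z \<in> carrier ?L"
  then obtain a s b t c r where mem: "a \<in> carrier R" "s \<in> S" "b \<in> carrier R" "t \<in> S"
      "c \<in> carrier R" "r \<in> S" and eq: "x = frac R S a s" "y = frac R S b t" "z = frac R S c r"
    by (metis localization_cases)
  \<comment> \<open>The right-hand side of distributivity carries a further factor \<open>r\<close>
    above and below, so the pairs differ and only their classes agree.\<close>
  have "frac R S ((a \<otimes> t \<oplus> b \<otimes> s) \<otimes> c) (s \<otimes> t \<otimes> r) =
      frac R S ((a \<otimes> c) \<otimes> (t \<otimes> r) \<oplus> (b \<otimes> c) \<otimes> (s \<otimes> r)) ((s \<otimes> r) \<otimes> (t \<otimes> r))"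
    using mem by (intro frac_eqI) (simp_all add: l_distr r_distr m_ac)
  then show "(x \<oplus>\<^bsub>?L\<^esub> y) \<otimes>\<^bsub>?L\<^esub> z = x \<otimes>\<^bsub>?L\<^esub> z \<oplus>\<^bsub>?L\<^esub> y \<otimes>\<^bsub>?L\<^esub> z"
    using mem unfolding eq by (simp add: frac_add frac_mult)
qed

lemma loc_map_hom: "loc_map R S \<in> ring_hom R (localization R S)"
  by (rule ring_hom_memI)
    (auto simp: loc_map_def frac_add frac_mult localization_one)

text \<open>The inverse is \<open>frac R S \<one> s\<close>. In this way a coefficient outside a
  maximal ideal becomes a unit value over the local ring.\<close>

lemma loc_map_Units:
  assumes "s \<in> S"
  shows "loc_map R S s \<in> Units (localization R S)"
proof -
  have "frac R S s s = frac R S \<one> \<one>"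
    by (rule frac_eqI) (use assms in simp_all)
  then have "frac R S \<one> s \<otimes>\<^bsub>localization R S\<^esub> loc_map R S s = \<one>\<^bsub>localization R S\<^esub>"
    "loc_map R S s \<otimes>\<^bsub>localization R S\<^esub> frac R S \<one> s = \<one>\<^bsub>localization R S\<^esub>"
    using assms by (simp_all add: loc_map_def frac_mult localization_one)
  then show ?thesis
    using assms unfolding Units_def by (auto simp: loc_map_def)
qed

end

lemma (in primeideal) mult_subset_Compl: "mult_subset R (carrier R - I)"
proof -
  have "submonoid (carrier R - I) R"
    using I_notcarr one_imp_carrier I_prime by unfold_locales auto
  then show ?thesis
    by (simp add: mult_subset_def is_cring)
qed

section \<open>Regular elements and the total ring of fractions\<close>

lemma regular_elements_carrier: "r \<in> regular_elements R \<Longrightarrow> r \<in> carrier R"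
  unfolding regular_elements_def by simp

lemma regular_elementsD:
  "r \<in> regular_elements R \<Longrightarrow> x \<in> carrier R \<Longrightarrow> r \<otimes>\<^bsub>R\<^esub> x = \<zero>\<^bsub>R\<^esub> \<Longrightarrow> x = \<zero>\<^bsub>R\<^esub>"
  unfolding regular_elements_def by blast

lemma regular_elementsI:
  "r \<in> carrier R \<Longrightarrow> (\<And>x. x \<in> carrier R \<Longrightarrow> r \<otimes>\<^bsub>R\<^esub> x = \<zero>\<^bsub>R\<^esub> \<Longrightarrow> x = \<zero>\<^bsub>R\<^esub>) \<Longrightarrow>
    r \<in> regular_elements R"
  unfolding regular_elements_def by blast

lemma (in cring) mult_subset_regular_elements: "mult_subset R (regular_elements R)"
proof -
  have "submonoid (regular_elements R) R"
  proof
    fix r t assume rt: "r \<in> regular_elements R" "t \<in> regular_elements R"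
    note carr = rt[THEN regular_elements_carrier]
    show "r \<otimes> t \<in> regular_elements R"
    proof (rule regular_elementsI)
      fix x assume x: "x \<in> carrier R" "r \<otimes> t \<otimes> x = \<zero>"
      then have "r \<otimes> (t \<otimes> x) = \<zero>"
        using carr by (simp add: m_assoc)
      then have "t \<otimes> x = \<zero>"
        using regular_elementsD[OF rt(1)] carr x by blast
      then show "x = \<zero>"
        using regular_elementsD[OF rt(2)] x by blast
    qed (use carr in simp)
  qed (auto intro: regular_elements_carrier regular_elementsI)
  then show ?thesis
    by (simp add: mult_subset_def is_cring)
qed

text \<open>Regularity is applied to \<open>x \<ominus> y\<close>. This cancellation replaces
  division by \<open>d\<close> and allows the local-global argument to stay inside
  \<open>R\<close>.\<close>

lemma (in cring) regular_elements_cancel: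
  assumes "d \<in> regular_elements R" "x \<in> carrier R" "y \<in> carrier R" "d \<otimes> x = d \<otimes> y"
  shows "x = y"
proof -
  have "d \<otimes> (x \<ominus> y) = \<zero>"
    using assms regular_elements_carrier[OF assms(1)] by (simp add: minus_eq r_distr r_minus r_neg)
  then have "x \<ominus> y = \<zero>"
    using regular_elementsD[OF assms(1)] assms(2,3) by blast
  then show ?thesis
    using assms by simp
qed

text \<open>Two equal fractions with denominator \<open>\<one>\<close> become equal numerators after
  multiplication by a regular element, which cancels. Equations in the total ring of fractions can
  thus be pulled back to \<open>R\<close>.\<close>

lemma (in cring) inj_on_total_map: "inj_on (total_map R) (carrier R)"
proof (rule inj_onI)
  interpret mult_subset R "regular_elements R"
    by (rule mult_subset_regular_elements)
  fix x y assume "x \<in> carrier R" "y \<in> carrier R" "total_map R x = total_map R y"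
  then obtain u where "u \<in> regular_elements R" "u \<otimes> (x \<otimes> \<one>) = u \<otimes> (y \<otimes> \<one>)"
    unfolding total_map_def loc_map_def using frac_eq_iff[of x \<one> y \<one>] by auto
  then show "x = y"
    using regular_elements_cancel \<open>x \<in> carrier R\<close> \<open>y \<in> carrier R\<close> by simp
qed

section \<open>Values of polynomials\<close>

text \<open>The factor that the monomial \<open>m\<close> contributes in \<open>mpoly_value\<close>,
  named so that it can be computed one indeterminate at a time.\<close>

definition monomial_value :: "('b, 'n) ring_scheme \<Rightarrow> nat \<Rightarrow> (nat \<Rightarrow> 'b) \<Rightarrow> nat multiset \<Rightarrow> 'b" where
  "monomial_value S n x m = (\<Otimes>\<^bsub>S\<^esub>i\<in>{..<n}. x i [^]\<^bsub>S\<^esub> count m i)"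

lemma (in cring) monomial_value_closed [simp]:
  "x \<in> {..<n} \<rightarrow> carrier R \<Longrightarrow> monomial_value R n x m \<in> carrier R"
  unfolding monomial_value_def by (intro finprod_closed) auto

lemma (in cring) monomial_value_empty [simp]: "monomial_value R n x {#} = \<one>"
  unfolding monomial_value_def by (simp add: finprod_one_eqI)

lemma (in cring) monomial_value_add_mset:
  assumes x: "x \<in> {..<n} \<rightarrow> carrier R" and k: "k < n"
  shows "monomial_value R n x (add_mset k m) = x k \<otimes> monomial_value R n x m"
proof -
  have "monomial_value R n x (add_mset k m) =
      (\<Otimes>i\<in>{..<n}. (if k = i then x i else \<one>) \<otimes> x i [^] count m i)"
    unfolding monomial_value_def using x by (intro finprod_cong') (auto simp: m_comm Pi_iff)
  also have "\<dots> = (\<Otimes>i\<in>{..<n}. if k = i then x i else \<one>) \<otimes> monomial_value R n x m"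
    unfolding monomial_value_def using x by (intro finprod_multf) auto
  also have "(\<Otimes>i\<in>{..<n}. if k = i then x i else \<one>) = x k"
    using x k by (intro finprod_singleton) auto
  finally show ?thesis .
qed

text \<open>In ordinary notation this is the sum over \<open>t\<close> in \<open>T\<close> of
  \<open>q t\<close> X_(a t) X_(b t), as a coefficient function. The inner sum collects the terms
  that share a monomial.\<close>

definition quadratic_poly ::
  "('a, 'm) ring_scheme \<Rightarrow> 't set \<Rightarrow> ('t \<Rightarrow> 'a) \<Rightarrow> ('t \<Rightarrow> 'i) \<Rightarrow> ('t \<Rightarrow> 'i) \<Rightarrow> 'i multiset \<Rightarrow> 'a" where
  "quadratic_poly R T q a b m = (\<Oplus>\<^bsub>R\<^esub>t\<in>T. if m = {#a t, b t#} then q t else \<zero>\<^bsub>R\<^esub>)"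

text \<open>A single term is a constant multiplied by two indeterminates, so this recursion uses
  only the operations that generate \<open>indexed_pset\<close> and gives membership by
  induction.\<close>

lemma (in cring) quadratic_poly_insert:
  assumes "finite T" "t \<notin> T" "q \<in> insert t T \<rightarrow> carrier R"
  shows "quadratic_poly R (insert t T) q a b =
    indexed_padd (indexed_pmult (indexed_pmult (indexed_const (q t)) (b t)) (a t))
      (quadratic_poly R T q a b)"
proof
  fix m
  have "indexed_pmult (indexed_pmult (indexed_const (q t)) (b t)) (a t) m =
      (if m = {#a t, b t#} then q t else \<zero>)"
    by (auto simp: indexed_pmult_def indexed_const_def multi_member_split
        dest!: multi_member_split split: if_splits)
  then show "quadratic_poly R (insert t T) q a b m =
      indexed_padd (indexed_pmult (indexed_pmult (indexed_const (q t)) (b t)) (a t))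
        (quadratic_poly R T q a b) m"
    using assms unfolding quadratic_poly_def indexed_padd_def
    by (subst finsum_insert) auto
qed

lemma (in cring) quadratic_poly_mem:
  assumes "finite T" "q \<in> T \<rightarrow> carrier R" "a \<in> T \<rightarrow> N" "b \<in> T \<rightarrow> N"
  shows "quadratic_poly R T q a b \<in> indexed_pset N (carrier R)"
  using assms
proof (induction T)
  case empty
  have "quadratic_poly R {} q a b = indexed_const \<zero>"
    by (simp add: quadratic_poly_def indexed_const_def fun_eq_iff)
  then show ?case
    by (auto intro: indexed_pset.indexed_const)
next
  case (insert t T)
  then show ?case
    by (auto simp: quadratic_poly_insert Pi_iff intro!: indexed_pset.intros)
qed

text \<open>Terms may share a monomial and coefficients may cancel, so the support is hard to
  describe. The sum is therefore first extended from the support to the finite set \<open>M\<close>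
  of all monomials that occur in the terms, which only adds zeros.\<close>

lemma quadratic_poly_value:
  assumes R: "cring R" and S: "cring S" and h: "h \<in> ring_hom R S"
    and T: "finite T" "q \<in> T \<rightarrow> carrier R" "a \<in> T \<rightarrow> {..<n}" "b \<in> T \<rightarrow> {..<n}"
    and x: "x \<in> {..<n} \<rightarrow> carrier S"
  shows "mpoly_value R S h n (quadratic_poly R T q a b) x =
    (\<Oplus>\<^bsub>S\<^esub>t\<in>T. h (q t) \<otimes>\<^bsub>S\<^esub> (x (a t) \<otimes>\<^bsub>S\<^esub> x (b t)))"
proof -
  interpret R: cring R by (rule R)
  interpret S: cring S by (rule S)
  interpret h: ring_hom_cring R S h
    using h R S by (simp add: ring_hom_cring_def ring_hom_cring_axioms_def)
  define p where "p = quadratic_poly R T q a b"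
  define M where "M = (\<lambda>t. {#a t, b t#}) ` T"
  have M: "finite M" unfolding M_def using T by simp
  have p_outside: "p m = \<zero>\<^bsub>R\<^esub>" if "m \<notin> M" for m
    unfolding p_def quadratic_poly_def using that unfolding M_def
    by (intro R.add.finprod_one_eqI) auto
  have p_closed: "p m \<in> carrier R" for m
    unfolding p_def quadratic_poly_def using T by (intro R.finsum_closed) auto
  have mv: "monomial_value S n x m \<in> carrier S" for m
    using x by simp
  have "mpoly_value R S h n p x = (\<Oplus>\<^bsub>S\<^esub>m\<in>{m. p m \<noteq> \<zero>\<^bsub>R\<^esub>}. h (p m) \<otimes>\<^bsub>S\<^esub> monomial_value S n x m)"
    by (simp add: mpoly_value_def monomial_value_def)
  also have "\<dots> = (\<Oplus>\<^bsub>S\<^esub>m\<in>M. h (p m) \<otimes>\<^bsub>S\<^esub> monomial_value S n x m)"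
    using M p_outside p_closed mv by (intro S.add.finprod_mono_neutral_cong_left) auto
  also have "\<dots> = (\<Oplus>\<^bsub>S\<^esub>t\<in>T. h (q t) \<otimes>\<^bsub>S\<^esub> monomial_value S n x {#a t, b t#})"
  \<comment> \<open>The induction removes terms from the polynomial but keeps the index set
    \<open>M\<close> of the outer sum fixed; each new term contributes at exactly one monomial of
    \<open>M\<close>.\<close>
  proof -
    have "(\<Oplus>\<^bsub>S\<^esub>m\<in>M. h (quadratic_poly R T' q a b m) \<otimes>\<^bsub>S\<^esub> monomial_value S n x m) =
        (\<Oplus>\<^bsub>S\<^esub>t\<in>T'. h (q t) \<otimes>\<^bsub>S\<^esub> monomial_value S n x {#a t, b t#})"
      if "finite T'" "T' \<subseteq> T" for T'
      using that
    proof (induction T')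
      case empty
      then show ?case
        using mv by (simp add: quadratic_poly_def)
    next
      case (insert t T')
      have closed: "quadratic_poly R T' q a b m \<in> carrier R" for m
        unfolding quadratic_poly_def using T insert.prems by (intro R.finsum_closed) auto
      have qt: "q t \<in> carrier R" using T insert.prems by auto
      have "h (quadratic_poly R (insert t T') q a b m) \<otimes>\<^bsub>S\<^esub> monomial_value S n x m =
          (if {#a t, b t#} = m then h (q t) \<otimes>\<^bsub>S\<^esub> monomial_value S n x m else \<zero>\<^bsub>S\<^esub>) \<oplus>\<^bsub>S\<^esub>
          h (quadratic_poly R T' q a b m) \<otimes>\<^bsub>S\<^esub> monomial_value S n x m" for m
      proof -
        have "quadratic_poly R (insert t T') q a b m =
            (if {#a t, b t#} = m then q t else \<zero>\<^bsub>R\<^esub>) \<oplus>\<^bsub>R\<^esub> quadratic_poly R T' q a b m"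
          using insert T unfolding quadratic_poly_def by (subst R.finsum_insert) auto
        then show ?thesis
          using closed[of m] qt mv[of m] by (simp add: S.l_distr)
      qed
      then have "(\<Oplus>\<^bsub>S\<^esub>m\<in>M. h (quadratic_poly R (insert t T') q a b m) \<otimes>\<^bsub>S\<^esub> monomial_value S n x m) =
          (\<Oplus>\<^bsub>S\<^esub>m\<in>M. if {#a t, b t#} = m then h (q t) \<otimes>\<^bsub>S\<^esub> monomial_value S n x m else \<zero>\<^bsub>S\<^esub>) \<oplus>\<^bsub>S\<^esub>
          (\<Oplus>\<^bsub>S\<^esub>m\<in>M. h (quadratic_poly R T' q a b m) \<otimes>\<^bsub>S\<^esub> monomial_value S n x m)"
        using closed qt mv by (simp only:) (intro S.finsum_addf; auto)
      also have "(\<Oplus>\<^bsub>S\<^esub>m\<in>M. if {#a t, b t#} = m then h (q t) \<otimes>\<^bsub>S\<^esub> monomial_value S n x m else \<zero>\<^bsub>S\<^esub>) =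
          h (q t) \<otimes>\<^bsub>S\<^esub> monomial_value S n x {#a t, b t#}"
        using M mv qt insert.prems by (intro S.finsum_singleton) (auto simp: M_def)
      finally show ?case
        using insert mv qt T by (subst S.finsum_insert) (auto simp: Pi_iff subset_iff)
    qed
    then show ?thesis
      unfolding p_def using T by simp
  qed
  also have "\<dots> = (\<Oplus>\<^bsub>S\<^esub>t\<in>T. h (q t) \<otimes>\<^bsub>S\<^esub> (x (a t) \<otimes>\<^bsub>S\<^esub> x (b t)))"
  proof (rule S.finsum_cong')
    fix t assume "t \<in> T"
    then have "a t < n" "b t < n" using T by auto
    with x show "h (q t) \<otimes>\<^bsub>S\<^esub> monomial_value S n x {#a t, b t#} =
        h (q t) \<otimes>\<^bsub>S\<^esub> (x (a t) \<otimes>\<^bsub>S\<^esub> x (b t))"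
      by (simp add: S.monomial_value_add_mset Pi_iff)
  qed (use T x in \<open>auto simp: Pi_iff\<close>)
  finally show ?thesis
    unfolding p_def .
qed

section \<open>Colon ideals and quotients by a regular element\<close>

lemma (in ideal) finsum_mem:
  "(\<And>i. i \<in> A \<Longrightarrow> f i \<in> I) \<Longrightarrow> (\<Oplus>i\<in>A. f i) \<in> I"
proof (induction A rule: infinite_finite_induct)
  case (insert a A)
  then have "(\<Oplus>i\<in>insert a A. f i) = f a \<oplus> (\<Oplus>i\<in>A. f i)"
    by (intro finsum_insert) (auto simp: Icarr)
  then show ?case
    using insert by simp
qed (simp_all add: finsum_infinite)

lemma (in cring) finsum_mult_product:
  assumes "finite A" "finite B" "f \<in> A \<rightarrow> carrier R" "g \<in> B \<rightarrow> carrier R"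
  shows "(\<Oplus>i\<in>A. f i) \<otimes> (\<Oplus>j\<in>B. g j) = (\<Oplus>p\<in>A \<times> B. f (fst p) \<otimes> g (snd p))"
  using assms(1,3)
proof (induction A)
  case empty
  then show ?case
    using assms by simp
next
  case (insert a A)
  have f: "f a \<in> carrier R" "f \<in> A \<rightarrow> carrier R"
    using insert.prems by auto
  have "insert a A \<times> B = Pair a ` B \<union> A \<times> B"
    by auto
  then have "(\<Oplus>p\<in>insert a A \<times> B. f (fst p) \<otimes> g (snd p)) =
      (\<Oplus>p\<in>Pair a ` B. f (fst p) \<otimes> g (snd p)) \<oplus> (\<Oplus>p\<in>A \<times> B. f (fst p) \<otimes> g (snd p))"
    using insert.hyps f assms by (auto simp: Pi_iff intro!: finsum_Un_disjoint)
  also have "(\<Oplus>p\<in>Pair a ` B. f (fst p) \<otimes> g (snd p)) = (\<Oplus>j\<in>B. f a \<otimes> g j)"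
    using f assms by (subst finsum_reindex) (auto simp: Pi_iff inj_on_def)
  also have "\<dots> = f a \<otimes> (\<Oplus>j\<in>B. g j)"
    using f assms by (intro finsum_rdistr[symmetric]) auto
  finally show ?case
    using insert.IH insert.hyps f assms by (simp add: finsum_insert l_distr)
qed

text \<open>By induction on the generation of the product: two families are concatenated, the second
  one shifted by \<open>n\<close>. Numbering the factors prepares for using them as coefficients at
  the numbered indeterminates of a form.\<close>

lemma (in ring) ideal_prod_finsum:
  assumes I: "ideal I R" and J: "ideal J R" and v: "v \<in> I \<cdot> J"
  shows "\<exists>(n::nat) x y. x \<in> {..<n} \<rightarrow> I \<and> y \<in> {..<n} \<rightarrow> J \<and> v = (\<Oplus>i\<in>{..<n}. x i \<otimes> y i)"
  using v
proof (induction rule: ideal_prod.induct)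
  case (prod i j)
  then have "i \<otimes> j = (\<Oplus>k\<in>{..<1::nat}. i \<otimes> j)"
    using ideal.Icarr[OF I] ideal.Icarr[OF J] by (simp add: lessThan_Suc)
  then show ?case
    using prod by (intro exI[of _ 1] exI[of _ "\<lambda>_. i"] exI[of _ "\<lambda>_. j"]) auto
next
  case (sum v1 v2)
  then obtain n m :: nat and x y x' y' where
    v1: "x \<in> {..<n} \<rightarrow> I" "y \<in> {..<n} \<rightarrow> J" "v1 = (\<Oplus>i\<in>{..<n}. x i \<otimes> y i)" and
    v2: "x' \<in> {..<m} \<rightarrow> I" "y' \<in> {..<m} \<rightarrow> J" "v2 = (\<Oplus>i\<in>{..<m}. x' i \<otimes> y' i)"
    by blast
  have carr: "x \<in> {..<n} \<rightarrow> carrier R" "y \<in> {..<n} \<rightarrow> carrier R"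
    "x' \<in> {..<m} \<rightarrow> carrier R" "y' \<in> {..<m} \<rightarrow> carrier R"
    using v1 v2 ideal.Icarr[OF I] ideal.Icarr[OF J] by (auto simp: Pi_iff)
  define x'' where "x'' i = (if i < n then x i else x' (i - n))" for i
  define y'' where "y'' i = (if i < n then y i else y' (i - n))" for i
  have split: "{..<n + m} = {..<n} \<union> (+) n ` {..<m}"
    by (simp add: lessThan_atLeast0 ivl_disj_un_two(3) add.commute)
  have *: "x'' i \<otimes> y'' i \<in> carrier R" if "i < n + m" for i
    using that carr by (auto simp: x''_def y''_def Pi_iff)
  have "(\<Oplus>i\<in>{..<n + m}. x'' i \<otimes> y'' i) =
      (\<Oplus>i\<in>{..<n}. x'' i \<otimes> y'' i) \<oplus> (\<Oplus>i\<in>(+) n ` {..<m}. x'' i \<otimes> y'' i)"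
    unfolding split using * by (intro finsum_Un_disjoint) auto
  also have "(\<Oplus>i\<in>{..<n}. x'' i \<otimes> y'' i) = v1"
    unfolding v1(3) using carr by (intro finsum_cong') (auto simp: x''_def y''_def Pi_iff)
  also have "(\<Oplus>i\<in>(+) n ` {..<m}. x'' i \<otimes> y'' i) = (\<Oplus>i\<in>{..<m}. x'' (n + i) \<otimes> y'' (n + i))"
    using * by (intro finsum_reindex) auto
  also have "\<dots> = v2"
    unfolding v2(3) using carr by (intro finsum_cong') (auto simp: x''_def y''_def Pi_iff)
  finally have "v1 \<oplus> v2 = (\<Oplus>i\<in>{..<n + m}. x'' i \<otimes> y'' i)" ..
  moreover have "x'' \<in> {..<n + m} \<rightarrow> I" "y'' \<in> {..<n + m} \<rightarrow> J"
    using v1 v2 by (auto simp: x''_def y''_def Pi_iff)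
  ultimately show ?case
    by blast
qed

text \<open>For regular \<open>d\<close> the elements are the numerators of the fractions y / d that
  multiply \<open>I\<close> into \<open>R\<close>, so an inverse of \<open>I\<close> can be handled
  inside the ring.\<close>

definition colon :: "('a, 'm) ring_scheme \<Rightarrow> 'a \<Rightarrow> 'a set \<Rightarrow> 'a set" where
  "colon R d I = {y \<in> carrier R. \<forall>z\<in>I. z \<otimes>\<^bsub>R\<^esub> y \<in> PIdl\<^bsub>R\<^esub> d}"

lemma colon_carrier: "y \<in> colon R d I \<Longrightarrow> y \<in> carrier R"
  by (simp add: colon_def)

lemma (in cring) colon_iff:
  assumes "d \<in> carrier R"
  shows "y \<in> colon R d I \<longleftrightarrow> y \<in> carrier R \<and> (\<forall>z\<in>I. \<exists>q\<in>carrier R. z \<otimes> y = d \<otimes> q)"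
  using assms unfolding colon_def cgenideal_def by (auto simp: m_comm; metis m_comm)

lemma (in cring) ideal_colon:
  assumes d: "d \<in> carrier R" and I: "I \<subseteq> carrier R"
  shows "ideal (colon R d I) R"
proof (rule idealI[OF ring_axioms])
  interpret D: ideal "PIdl d" R
    by (rule cgenideal_ideal[OF d])
  show "subgroup (colon R d I) (add_monoid R)"
  proof (rule add.subgroupI)
    have "z \<otimes> \<zero> \<in> PIdl d" if "z \<in> I" for z
      using that I D.zero_closed by auto
    then show "colon R d I \<noteq> {}"
      unfolding colon_def by blast
    fix y assume y: "y \<in> colon R d I"
    then have "z \<otimes> (\<ominus> y) = \<ominus> (z \<otimes> y)" if "z \<in> I" for z
      using that I by (auto simp: colon_def r_minus)
    then show "\<ominus> y \<in> colon R d I"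
      using y I by (auto simp: colon_def)
    fix y' assume y': "y' \<in> colon R d I"
    have "z \<otimes> (y \<oplus> y') = z \<otimes> y \<oplus> z \<otimes> y'" if "z \<in> I" for z
      using that y y' I by (auto simp: colon_def r_distr)
    then show "y \<oplus> y' \<in> colon R d I"
      using y y' by (auto simp: colon_def)
  qed (auto simp: colon_def)
  fix y x assume yx: "y \<in> colon R d I" "x \<in> carrier R"
  have "z \<otimes> (y \<otimes> x) = (z \<otimes> y) \<otimes> x" if "z \<in> I" for z
    using that yx I by (auto simp: colon_def m_assoc)
  then show "y \<otimes> x \<in> colon R d I"
    using yx D.I_r_closed by (auto simp: colon_def)
  then show "x \<otimes> y \<in> colon R d I"
    using yx by (simp add: m_comm colon_carrier)
qed

lemma (in ideal) carrier_Quot: "carrier (R Quot I) = (+>) I ` carrier R"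
  by (auto simp: FactRing_def A_RCOSETS_def RCOSETS_def a_r_coset_def)

text \<open>The diagonal coefficients sum to \<open>\<one>\<close>, so no maximal ideal of the
  quotient contains all of them, and the form has a unit value over each local ring. A point with a
  unit value over the quotient, lifted to \<open>R\<close>, supplies the coefficients that combine
  the \<open>x i\<close> and the \<open>y j\<close> into the two required factors. The final
  equation says that \<open>w\<close> is a unit modulo \<open>s\<close>.\<close>

lemma (in cring) local_global_colon:
  assumes I: "ideal I R" and d: "d \<in> regular_elements R" "d \<in> I \<cdot> colon R d I"
    and s: "s \<in> carrier R" and lg: "local_global (R Quot (PIdl s))"
  shows "\<exists>x\<in>I. \<exists>y\<in>colon R d I. \<exists>w\<in>carrier R. \<exists>r\<in>carrier R. \<exists>t\<in>carrier R.
    x \<otimes> y = d \<otimes> w \<and> w \<otimes> r \<oplus> s \<otimes> t = \<one>"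
proof -
  note dR = regular_elements_carrier[OF d(1)]
  interpret I: ideal I R by (rule I)
  interpret C: ideal "colon R d I" R
    by (rule ideal_colon[OF dR]) auto
  interpret S: ideal "PIdl s" R
    by (rule cgenideal_ideal[OF s])
  define Q where "Q = R Quot (PIdl s)"
  define \<pi> where "\<pi> = (+>) (PIdl s)"
  interpret \<pi>: ring_hom_cring R Q \<pi>
    unfolding Q_def \<pi>_def by (rule S.rcos_ring_hom_cring[OF is_cring])
  have carrier_Q: "carrier Q = \<pi> ` carrier R"
    unfolding Q_def \<pi>_def by (rule S.carrier_Quot)
  obtain n :: nat and x y where x: "x \<in> {..<n} \<rightarrow> I" and y: "y \<in> {..<n} \<rightarrow> colon R d I"
    and dxy: "d = (\<Oplus>i\<in>{..<n}. x i \<otimes> y i)"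
    using ideal_prod_finsum[OF I C.is_ideal d(2)] by blast
  have xR: "x i \<in> carrier R" and yR: "y i \<in> carrier R" if "i < n" for i
    using that x y I.Icarr C.Icarr by (simp_all add: Pi_iff)
  have "\<exists>c\<in>carrier R. x i \<otimes> y j = d \<otimes> c" if "i < n" "j < n" for i j
    using that x y colon_iff[OF dR] by blast
  then obtain c where c: "\<And>i j. i < n \<Longrightarrow> j < n \<Longrightarrow> c i j \<in> carrier R"
    and xyc: "\<And>i j. i < n \<Longrightarrow> j < n \<Longrightarrow> x i \<otimes> y j = d \<otimes> c i j"
    by metis
  \<comment> \<open>The trace of \<open>c\<close> is \<open>\<one>\<close>, since multiplication by
    \<open>d\<close> turns it into the sum that represents \<open>d\<close>.\<close>
  have "d \<otimes> (\<Oplus>i\<in>{..<n}. c i i) = (\<Oplus>i\<in>{..<n}. d \<otimes> c i i)"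
    using c dR by (intro finsum_rdistr) auto
  also have "\<dots> = (\<Oplus>i\<in>{..<n}. x i \<otimes> y i)"
    using c dR xR yR xyc by (intro finsum_cong') auto
  finally have "d \<otimes> (\<Oplus>i\<in>{..<n}. c i i) = d \<otimes> \<one>"
    using dxy dR by simp
  then have trace: "(\<Oplus>i\<in>{..<n}. c i i) = \<one>"
    by (rule regular_elements_cancel[OF d(1), rotated 2]) (use c in auto)
  define T where "T = {..<n} \<times> {..<n}"
  define q where "q t = \<pi> (c (fst t) (snd t))" for t
  \<comment> \<open>The indeterminates X are numbered from \<open>0\<close> to \<open>n - 1\<close>;
    the shift by \<open>n\<close> gives the indeterminates Y the numbers from \<open>n\<close> to
    \<open>2 * n - 1\<close>.\<close>
  define b where "b t = n + snd t" for t :: "nat \<times> nat"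
  define f where "f = quadratic_poly Q T q fst b"
  have T: "finite T" "q \<in> T \<rightarrow> carrier Q" "fst \<in> T \<rightarrow> {..<2 * n}" "b \<in> T \<rightarrow> {..<2 * n}"
    using c by (auto simp: T_def q_def b_def)
  have "admits_unit_value Q (localization Q (carrier Q - P)) (loc_map Q (carrier Q - P)) (2 * n) f"
    if P: "maximalideal P Q" for P
  proof -
    interpret P: primeideal P Q
      using \<pi>.S.maximalideal_prime[OF P] .
    interpret L: mult_subset Q "carrier Q - P"
      by (rule P.mult_subset_Compl)
    define L where "L = localization Q (carrier Q - P)"
    define h where "h = loc_map Q (carrier Q - P)"
    interpret L: cring L
      unfolding L_def by (rule L.cring_localization)
    have h: "h \<in> ring_hom Q L"
      unfolding L_def h_def by (rule L.loc_map_hom)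
    \<comment> \<open>Otherwise \<open>P\<close> would contain the image of the trace, which is the
      identity.\<close>
    have "\<exists>k<n. \<pi> (c k k) \<notin> P"
    proof (rule ccontr)
      assume *: "\<not> (\<exists>k<n. \<pi> (c k k) \<notin> P)"
      then have "(\<Oplus>\<^bsub>Q\<^esub>k\<in>{..<n}. \<pi> (c k k)) \<in> P"
        by (intro P.finsum_mem) auto
      also have "(\<Oplus>\<^bsub>Q\<^esub>k\<in>{..<n}. \<pi> (c k k)) = \<pi> (\<Oplus>k\<in>{..<n}. c k k)"
        using c by (subst \<pi>.hom_finsum) (auto simp: o_def)
      finally show False
        using P.one_imp_carrier P.I_notcarr by (simp add: trace)
    qed
    then obtain k where k: "k < n" "\<pi> (c k k) \<notin> P"
      by blast
    \<comment> \<open>The point at which X and Y with index \<open>k\<close> are one and all other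
      coordinates zero, so that only the coefficient \<open>c k k\<close> survives.\<close>
    define \<epsilon> where "\<epsilon> i = (if i = k \<or> i = n + k then \<one>\<^bsub>L\<^esub> else \<zero>\<^bsub>L\<^esub>)" for i
    have \<epsilon>: "\<epsilon> \<in> {..<2 * n} \<rightarrow> carrier L"
      by (simp add: \<epsilon>_def)
    have hq: "h (q t) \<in> carrier L" if "t \<in> T" for t
      by (rule ring_hom_closed[OF h funcset_mem[OF T(2) that]])
    have "mpoly_value Q L h (2 * n) f \<epsilon> =
        (\<Oplus>\<^bsub>L\<^esub>t\<in>T. h (q t) \<otimes>\<^bsub>L\<^esub> (\<epsilon> (fst t) \<otimes>\<^bsub>L\<^esub> \<epsilon> (b t)))"
      unfolding f_def by (rule quadratic_poly_value[OF \<pi>.S.is_cring L.is_cring h T \<epsilon>])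
    also have "\<dots> = (\<Oplus>\<^bsub>L\<^esub>t\<in>T. if (k, k) = t then h (q t) else \<zero>\<^bsub>L\<^esub>)"
    proof (rule L.finsum_cong')
      fix t assume t: "t \<in> T"
      then have "\<epsilon> (fst t) = (if fst t = k then \<one>\<^bsub>L\<^esub> else \<zero>\<^bsub>L\<^esub>)"
        "\<epsilon> (b t) = (if snd t = k then \<one>\<^bsub>L\<^esub> else \<zero>\<^bsub>L\<^esub>)"
        using k by (auto simp: \<epsilon>_def b_def T_def)
      then show "h (q t) \<otimes>\<^bsub>L\<^esub> (\<epsilon> (fst t) \<otimes>\<^bsub>L\<^esub> \<epsilon> (b t)) = (if (k, k) = t then h (q t) else \<zero>\<^bsub>L\<^esub>)"
        using hq[OF t] by (cases t) auto
    qed (use hq in auto)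
    also have "\<dots> = h (q (k, k))"
      using T(1) hq k by (intro L.finsum_singleton) (auto simp: T_def)
    also have "\<dots> \<in> Units L"
      unfolding L_def h_def q_def using c k by (intro L.loc_map_Units) auto
    finally show ?thesis
      unfolding admits_unit_value_def L_def[symmetric] h_def[symmetric] using \<epsilon> by blast
  qed
  moreover have "f \<in> ring.indexed_pset Q {..<2 * n} (carrier Q)"
    unfolding f_def using T by (rule \<pi>.S.quadratic_poly_mem)
  ultimately have "admits_unit_value Q Q id (2 * n) f"
    using lg unfolding local_global_def Q_def[symmetric] by blast
  then obtain \<zeta> where \<zeta>: "\<zeta> \<in> {..<2 * n} \<rightarrow> carrier Q" and unit: "mpoly_value Q Q id (2 * n) f \<zeta> \<in> Units Q"
    unfolding admits_unit_value_def by blast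
  have "\<exists>\<xi>. \<xi> \<in> carrier R \<and> \<zeta> i = \<pi> \<xi>" if "i < 2 * n" for i
    using funcset_mem[OF \<zeta>, of i] that unfolding carrier_Q by auto
  then obtain \<xi> where \<xi>: "\<And>i. i < 2 * n \<Longrightarrow> \<xi> i \<in> carrier R" "\<And>i. i < 2 * n \<Longrightarrow> \<zeta> i = \<pi> (\<xi> i)"
    by metis
  have \<xi>T: "c (fst t) (snd t) \<in> carrier R" "\<xi> (fst t) \<in> carrier R" "\<xi> (b t) \<in> carrier R"
    "\<zeta> (fst t) = \<pi> (\<xi> (fst t))" "\<zeta> (b t) = \<pi> (\<xi> (b t))" if "t \<in> T" for t
    using that c \<xi> by (auto simp: T_def b_def)
  \<comment> \<open>The form over \<open>R\<close> evaluated at the lifted point; its image in the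
    quotient is the unit value.\<close>
  define w where "w = (\<Oplus>t\<in>T. c (fst t) (snd t) \<otimes> (\<xi> (fst t) \<otimes> \<xi> (b t)))"
  have w: "w \<in> carrier R"
    unfolding w_def using \<xi>T by (intro finsum_closed) auto
  have "mpoly_value Q Q id (2 * n) f \<zeta> = (\<Oplus>\<^bsub>Q\<^esub>t\<in>T. id (q t) \<otimes>\<^bsub>Q\<^esub> (\<zeta> (fst t) \<otimes>\<^bsub>Q\<^esub> \<zeta> (b t)))"
    unfolding f_def by (rule quadratic_poly_value[OF \<pi>.S.is_cring \<pi>.S.is_cring _ T \<zeta>]) (simp add: ring_hom_def)
  also have "\<dots> = (\<Oplus>\<^bsub>Q\<^esub>t\<in>T. (\<pi> \<circ> (\<lambda>t. c (fst t) (snd t) \<otimes> (\<xi> (fst t) \<otimes> \<xi> (b t)))) t)"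
    using \<xi>T by (intro \<pi>.S.finsum_cong') (auto simp: q_def)
  also have "\<dots> = \<pi> w"
    unfolding w_def using \<xi>T by (subst \<pi>.hom_finsum) (auto simp: o_def)
  finally have "\<pi> w \<in> Units Q"
    using unit by simp
  then obtain r' where "r' \<in> carrier Q" "\<pi> w \<otimes>\<^bsub>Q\<^esub> r' = \<one>\<^bsub>Q\<^esub>"
    unfolding Units_def by auto
  then obtain r where r: "r \<in> carrier R" "\<pi> w \<otimes>\<^bsub>Q\<^esub> \<pi> r = \<one>\<^bsub>Q\<^esub>"
    using carrier_Q by auto
  then have "\<pi> (\<one>) = \<pi> (w \<otimes> r)"
    using w by simp
  then have "\<one> \<ominus> w \<otimes> r \<in> PIdl s"
    unfolding \<pi>_def using quotient_eq_iff_same_a_r_cos[OF S.is_ideal] w r by simp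
  then obtain t where t: "t \<in> carrier R" "\<one> \<ominus> w \<otimes> r = t \<otimes> s"
    unfolding cgenideal_def by auto
  have "w \<otimes> r \<oplus> s \<otimes> t = w \<otimes> r \<oplus> (\<one> \<ominus> w \<otimes> r)"
    using t s by (simp add: m_comm)
  also have "\<dots> = \<one>"
    using w r by (simp add: minus_eq a_lcomm[of "w \<otimes> r"] r_neg)
  finally have wrst: "w \<otimes> r \<oplus> s \<otimes> t = \<one>" .
  \<comment> \<open>The X-coordinates combine the \<open>x i\<close>, the Y-coordinates the
    \<open>y j\<close>. Since \<open>x i \<otimes> y j = d \<otimes> c i j\<close>, the product of
    the two combinations is \<open>d\<close> times the value \<open>w\<close>.\<close>
  define x' where "x' = (\<Oplus>i\<in>{..<n}. \<xi> i \<otimes> x i)"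
  define y' where "y' = (\<Oplus>j\<in>{..<n}. \<xi> (n + j) \<otimes> y j)"
  have x': "x' \<in> I"
    unfolding x'_def using \<xi> x by (intro I.finsum_mem I.I_l_closed) auto
  have y': "y' \<in> colon R d I"
    unfolding y'_def using \<xi> y by (intro C.finsum_mem C.I_l_closed) auto
  have "x' \<otimes> y' = (\<Oplus>t\<in>T. (\<xi> (fst t) \<otimes> x (fst t)) \<otimes> (\<xi> (n + snd t) \<otimes> y (snd t)))"
    unfolding x'_def y'_def T_def using \<xi> xR yR by (intro finsum_mult_product) auto
  also have "\<dots> = (\<Oplus>t\<in>T. d \<otimes> (c (fst t) (snd t) \<otimes> (\<xi> (fst t) \<otimes> \<xi> (b t))))"
  proof (rule finsum_cong')
    fix t assume t: "t \<in> T"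
    then have lt: "fst t < n" "snd t < n" by (auto simp: T_def)
    have "(\<xi> (fst t) \<otimes> x (fst t)) \<otimes> (\<xi> (n + snd t) \<otimes> y (snd t)) =
        (x (fst t) \<otimes> y (snd t)) \<otimes> (\<xi> (fst t) \<otimes> \<xi> (b t))"
      using lt xR yR \<xi> by (simp add: b_def m_ac)
    also have "\<dots> = d \<otimes> (c (fst t) (snd t) \<otimes> (\<xi> (fst t) \<otimes> \<xi> (b t)))"
      using lt xyc \<xi>T[OF t] dR by (simp add: m_assoc)
    finally show "(\<xi> (fst t) \<otimes> x (fst t)) \<otimes> (\<xi> (n + snd t) \<otimes> y (snd t)) =
        d \<otimes> (c (fst t) (snd t) \<otimes> (\<xi> (fst t) \<otimes> \<xi> (b t)))" .
  qed (use \<xi>T dR in auto)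
  also have "\<dots> = d \<otimes> w"
    unfolding w_def using \<xi>T dR T by (intro finsum_rdistr[symmetric]) auto
  finally show ?thesis
    using x' y' w r t wrst by blast
qed

section \<open>Projective and invertible ideals\<close>

text \<open>
  By the dual basis lemma \<open>a = \<Sum> \<phi>\<^sub>i(a) u\<^sub>i\<close> with linear forms \<open>\<phi>\<^sub>i\<close> on \<open>J\<close>; and \<open>z \<phi>\<^sub>i(a) = a \<phi>\<^sub>i(z)\<close>.
\<close>

lemma (in cring) projective_imp_mem_prod_colon:
  assumes J: "ideal J R" and proj: "projective_module R (ideal_module R J)" and a: "a \<in> J"
  shows "a \<in> J \<cdot> colon R a J"
proof -
  interpret J: ideal J R by (rule J)
  have aR: "a \<in> carrier R" using a by (rule J.Icarr)
  obtain B :: "'a set" and K L h where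
    K: "submodule K R (free_module R B)" and L: "submodule L R (free_module R B)" and
    KL0: "K \<inter> L = {\<zero>\<^bsub>free_module R B\<^esub>}" and
    KL: "K <+>\<^bsub>free_module R B\<^esub> L = carrier (free_module R B)" and
    h: "h \<in> mod_hom R (ideal_module R J) ((free_module R B)\<lparr>carrier := K\<rparr>)" and
    bij: "bij_betw h J K"
    using proj unfolding projective_module_def mod_isomorphic_def
    by (auto simp: ideal_module_def)
  interpret K: submodule K R "free_module R B" by (rule K)
  interpret L: submodule L R "free_module R B" by (rule L)
  have K_free: "f i \<in> carrier R" "i \<notin> B \<Longrightarrow> f i = \<zero>" "finite {i. f i \<noteq> \<zero>}" if "f \<in> K" for f i
    using subsetD[OF K.subset that] by (cases "i \<in> B"; auto simp: free_module_def)+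
  have L_free: "f i \<in> carrier R" if "f \<in> L" for f i
    using subsetD[OF L.subset that] by (cases "i \<in> B") (auto simp: free_module_def)
  have hK: "h z \<in> K" if "z \<in> J" for z
    using bij that by (auto simp: bij_betw_def)
  note hR = K_free(1)[OF hK]
  have h_add: "h (x \<oplus> y) i = h x i \<oplus> h y i" if "x \<in> J" "y \<in> J" for x y i
    using h that by (auto simp: mod_hom_def ideal_module_def ring_module_def free_module_def)
  have h_smult: "h (r \<otimes> x) i = r \<otimes> h x i" if "r \<in> carrier R" "x \<in> J" for r x i
    using h that by (auto simp: mod_hom_def ideal_module_def ring_module_def free_module_def)
  have h_zero: "h \<zero> i = \<zero>" for i
    using h_smult[of \<zero> a i] a aR hR[OF a] by simp
  have h_finsum: "h (\<Oplus>k\<in>A. u k) i = (\<Oplus>k\<in>A. h (u k) i)" if "finite A" "u \<in> A \<rightarrow> J" for A u i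
    using that
  proof (induction A)
    case empty
    then show ?case by (simp add: h_zero)
  next
    case (insert k A)
    have uJ: "u k \<in> J" "u \<in> A \<rightarrow> J" and uR: "u \<in> A \<rightarrow> carrier R"
      using insert.prems J.Icarr by (auto simp: Pi_iff)
    have "h (\<Oplus>k\<in>insert k A. u k) i = h (u k \<oplus> (\<Oplus>k\<in>A. u k)) i"
      using insert.hyps uJ uR by (simp add: finsum_insert J.Icarr)
    also have "\<dots> = h (u k) i \<oplus> (\<Oplus>k\<in>A. h (u k) i)"
      using uJ insert.IH by (subst h_add) (auto intro!: J.finsum_mem simp: Pi_iff)
    also have "\<dots> = (\<Oplus>k\<in>insert k A. h (u k) i)"
      using insert.hyps uJ hR by (subst finsum_insert) (auto simp: Pi_iff)
    finally show ?case .
  qed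
  define D where "D = {i. h a i \<noteq> \<zero>}"
  have D: "finite D" "D \<subseteq> B"
    unfolding D_def using K_free[OF hK[OF a]] by auto
  \<comment> \<open>The standard basis vectors. Each splits into a part in \<open>K\<close> and a
    part in \<open>L\<close>.\<close>
  define e where "e i j = (if i = j then \<one> else \<zero>)" for i j :: 'a
  have "\<exists>k l. k \<in> K \<and> l \<in> L \<and> (\<forall>j. e i j = k j \<oplus> l j)" if "i \<in> B" for i
  proof -
    have "{j. e i j \<noteq> \<zero>} \<subseteq> {i}"
      by (auto simp: e_def)
    then have "finite {j. e i j \<noteq> \<zero>}"
      by (rule finite_subset) simp
    then have "e i \<in> carrier (free_module R B)"
      using that by (auto simp: free_module_def e_def)
    then obtain k l where "k \<in> K" "l \<in> L" "e i = k \<oplus>\<^bsub>free_module R B\<^esub> l"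
      unfolding KL[symmetric] set_add_def' by auto
    then show ?thesis
      by (intro exI[of _ k] exI[of _ l]) (simp add: free_module_def)
  qed
  then obtain k l where k: "\<And>i. i \<in> B \<Longrightarrow> k i \<in> K" and l: "\<And>i. i \<in> B \<Longrightarrow> l i \<in> L"
    and ekl: "\<And>i j. i \<in> B \<Longrightarrow> e i j = k i j \<oplus> l i j"
    by metis
  \<comment> \<open>The part in \<open>K\<close> pulled back along \<open>h\<close>. Together with
    the coordinate forms of \<open>h\<close> these elements are the dual basis.\<close>
  define u where "u i = inv_into J h (k i)" for i
  have u: "u i \<in> J" "h (u i) = k i" if "i \<in> B" for i
    using k[OF that] bij unfolding u_def bij_betw_def by (auto intro: inv_into_into f_inv_into_f)
  have kR: "k i j \<in> carrier R" and lR: "l i j \<in> carrier R" if "i \<in> B" for i j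
    using K_free(1)[OF k[OF that]] L_free[OF l[OF that]] by blast+
  \<comment> \<open>The dual basis expansion of \<open>a\<close>, to be shown equal to
    \<open>a\<close>. Its deviation is measured by \<open>m\<close>, whose index set stays variable
    for an induction showing that the sum lies in \<open>L\<close>.\<close>
  define v where "v = (\<Oplus>i\<in>D. h a i \<otimes> u i)"
  define m where "m A j = (\<Oplus>i\<in>A. h a i \<otimes> l i j)" for A j
  have hau: "h a i \<otimes> u i \<in> J" if "i \<in> D" for i
    using that u D hR[OF a] by (intro J.I_l_closed) auto
  have v: "v \<in> J"
    unfolding v_def using hau by (rule J.finsum_mem)
  have m: "m A \<in> L" if "finite A" "A \<subseteq> B" for A
    using that
  proof (induction A)
    case empty
    have "m {} = \<zero>\<^bsub>free_module R B\<^esub>"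
      by (simp add: m_def free_module_def fun_eq_iff)
    then show ?case
      using KL0 by auto
  next
    case (insert i A)
    have "m (insert i A) = (h a i \<odot>\<^bsub>free_module R B\<^esub> l i) \<oplus>\<^bsub>free_module R B\<^esub> m A"
    proof
      fix j
      have "m (insert i A) j = h a i \<otimes> l i j \<oplus> m A j"
        unfolding m_def using insert lR hR[OF a] by (intro finsum_insert) (auto simp: Pi_iff subset_iff)
      then show "m (insert i A) j = ((h a i \<odot>\<^bsub>free_module R B\<^esub> l i) \<oplus>\<^bsub>free_module R B\<^esub> m A) j"
        by (simp add: free_module_def)
    qed
    also have "\<dots> \<in> L"
      using L.m_closed L.smult_closed[OF hR[OF a] l] insert by simp
    finally show ?case .
  qed
  have mR: "m D j \<in> carrier R" for j
    using L_free m D by blast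
  \<comment> \<open>The vector \<open>h a\<close> is the combination of the \<open>e i\<close> with
    coefficients \<open>h a i\<close>; splitting each \<open>e i\<close> turns it into
    \<open>h v\<close> plus \<open>m D\<close>. The difference thus lies in both \<open>K\<close>
    and \<open>L\<close>, and so vanishes.\<close>
  have "h (a \<ominus> v) j = m D j" for j
  proof -
    have "h v j = (\<Oplus>i\<in>D. h (h a i \<otimes> u i) j)"
      unfolding v_def using D hau by (intro h_finsum) auto
    also have "\<dots> = (\<Oplus>i\<in>D. h a i \<otimes> k i j)"
      using D hR[OF a] u kR by (intro finsum_cong') (auto simp: h_smult Pi_iff subset_iff)
    finally have hv: "h v j = (\<Oplus>i\<in>D. h a i \<otimes> k i j)" .
    have "h v j \<oplus> m D j = (\<Oplus>i\<in>D. h a i \<otimes> k i j \<oplus> h a i \<otimes> l i j)"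
      unfolding hv m_def using D hR[OF a] kR lR by (intro finsum_addf[symmetric]) auto
    also have "\<dots> = (\<Oplus>i\<in>D. if j = i then h a i else \<zero>)"
    proof (rule finsum_cong')
      fix i assume "i \<in> D"
      then have i: "i \<in> B" using D by auto
      have "h a i \<otimes> k i j \<oplus> h a i \<otimes> l i j = h a i \<otimes> e i j"
        using ekl[OF i] kR[OF i] lR[OF i] hR[OF a] by (simp add: r_distr)
      then show "h a i \<otimes> k i j \<oplus> h a i \<otimes> l i j = (if j = i then h a i else \<zero>)"
        using hR[OF a] by (auto simp: e_def)
    qed (use hR[OF a] in auto)
    also have "\<dots> = h a j"
    proof (cases "j \<in> D")
      case True
      then show ?thesis
        using D hR[OF a] by (intro finsum_singleton) auto
    next
      case False
      then have "(\<Oplus>i\<in>D. if j = i then h a i else \<zero>) = \<zero>"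
        by (intro add.finprod_one_eqI) auto
      then show ?thesis
        using False by (simp add: D_def)
    qed
    also have "\<dots> = h ((a \<ominus> v) \<oplus> v) j"
      using aR J.Icarr[OF v] by (simp add: minus_eq a_assoc l_neg)
    also have "\<dots> = h v j \<oplus> h (a \<ominus> v) j"
      using a v J.a_closed J.a_inv_closed hR by (subst h_add) (auto simp: minus_eq a_comm)
    finally show ?thesis
      using hR[OF v] mR hR[of "a \<ominus> v" j] a v by (simp add: minus_eq)
  qed
  then have "h (a \<ominus> v) = m D" ..
  moreover have av: "a \<ominus> v \<in> J"
    using a v by (simp add: minus_eq)
  ultimately have "h (a \<ominus> v) \<in> K \<inter> L"
    using hK[OF av] m[OF D] by simp
  then have "h (a \<ominus> v) = h \<zero>"
    unfolding KL0 by (simp add: free_module_def h_zero fun_eq_iff)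
  then have "a \<ominus> v = \<zero>"
    using bij av J.zero_closed unfolding bij_betw_def inj_on_def by blast
  then have "a = v"
    using aR J.Icarr[OF v] by simp
  moreover have "v \<in> J \<cdot> colon R a J"
  proof -
    interpret P: ideal "J \<cdot> colon R a J" R
      using ideal_prod_is_ideal[OF J ideal_colon[OF aR]] J.Icarr by blast
    have "h a i \<otimes> u i \<in> J \<cdot> colon R a J" if "i \<in> D" for i
    proof -
      \<comment> \<open>Both sides are the coordinate \<open>i\<close> of
        \<open>h (z \<otimes> a)\<close>, by linearity in either factor.\<close>
      have "z \<otimes> h a i = a \<otimes> h z i" if z: "z \<in> J" for z
        using h_smult[of z a i] h_smult[of a z i] z a aR J.Icarr by (simp add: m_comm)
      then have "h a i \<in> colon R a J"
        using hR a by (auto simp: colon_iff[OF aR])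
      then have "u i \<otimes> h a i \<in> J \<cdot> colon R a J"
        using u that D by (intro ideal_prod.prod) auto
      moreover have "u i \<in> carrier R"
        using u that D J.Icarr by auto
      ultimately show ?thesis
        using hR[OF a] by (simp add: m_comm)
    qed
    then show ?thesis
      unfolding v_def by (rule P.finsum_mem)
  qed
  ultimately show ?thesis by simp
qed

text \<open>An inverse \<open>B\<close> of \<open>I\<close> with \<open>d B \<subseteq> R\<close> satisfies \<open>d B \<subseteq> (d R : I)\<close>.\<close>

lemma (in cring) invertible_ideal_regular:
  assumes "invertible_ideal R I"
  shows "\<exists>d\<in>regular_elements R. d \<in> I \<cdot> colon R d I"
proof -
  define K where "K = total_fractions R"
  define \<iota> where "\<iota> = total_map R"
  from assms obtain B d where I: "ideal I R"
    and B: "submodule B R (total_fractions_module R)" and d: "d \<in> regular_elements R"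
    and dB: "\<And>b. b \<in> B \<Longrightarrow> \<iota> d \<otimes>\<^bsub>K\<^esub> b \<in> \<iota> ` carrier R"
    and IB: "(\<iota> ` I) \<cdot>\<^bsub>K\<^esub> B = \<iota> ` carrier R"
    unfolding invertible_ideal_def fractional_ideal_def K_def \<iota>_def by blast
  interpret I: ideal I R by (rule I)
  interpret T: mult_subset R "regular_elements R"
    by (rule mult_subset_regular_elements)
  interpret \<iota>: ring_hom_cring R K \<iota>
    unfolding K_def \<iota>_def total_fractions_def total_map_def
    using T.loc_map_hom T.cring_localization is_cring
    by (simp add: ring_hom_cring_def ring_hom_cring_axioms_def)
  have inj: "x = y" if "\<iota> x = \<iota> y" "x \<in> carrier R" "y \<in> carrier R" for x y
    using inj_on_total_map that unfolding \<iota>_def inj_on_def by blast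
  interpret B: submodule B R "total_fractions_module R" by (rule B)
  have BK: "b \<in> carrier K" if "b \<in> B" for b
    using B.subset that by (auto simp: total_fractions_module_def K_def)
  note dR = regular_elements_carrier[OF d]
  \<comment> \<open>Multiplication by \<open>d\<close> carries the product of \<open>I\<close> and
    \<open>B\<close> into the image of \<open>I \<cdot> colon R d I\<close>. Membership in
    \<open>carrier K\<close> is carried along because the sum case needs distributivity.\<close>
  have "x \<in> carrier K \<and> (\<exists>v \<in> I \<cdot> colon R d I. \<iota> d \<otimes>\<^bsub>K\<^esub> x = \<iota> v)" if "x \<in> (\<iota> ` I) \<cdot>\<^bsub>K\<^esub> B" for x
    using that
  proof (induction rule: ideal_prod.induct)
    case (prod x' b)
    then obtain z where z: "z \<in> I" "x' = \<iota> z" by blast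
    have zR: "z \<in> carrier R" using z by auto
    have bK: "b \<in> carrier K" using prod BK by blast
    obtain y where y: "y \<in> carrier R" "\<iota> d \<otimes>\<^bsub>K\<^esub> b = \<iota> y"
      using dB[OF prod(2)] by auto
    have swap: "\<iota> d \<otimes>\<^bsub>K\<^esub> (\<iota> z' \<otimes>\<^bsub>K\<^esub> b) = \<iota> (z' \<otimes> y)" if "z' \<in> carrier R" for z'
    proof -
      have "\<iota> d \<otimes>\<^bsub>K\<^esub> (\<iota> z' \<otimes>\<^bsub>K\<^esub> b) = \<iota> z' \<otimes>\<^bsub>K\<^esub> (\<iota> d \<otimes>\<^bsub>K\<^esub> b)"
        using that dR bK by (intro \<iota>.S.m_lcomm) auto
      then show ?thesis
        using that y by simp
    qed
    \<comment> \<open>The product of \<open>\<iota> z'\<close> with \<open>b\<close> lies in the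
      product of \<open>I\<close> and \<open>B\<close>, hence in the image of \<open>R\<close>; this
      provides \<open>q\<close>.\<close>
    have "\<exists>q\<in>carrier R. z' \<otimes> y = d \<otimes> q" if z': "z' \<in> I" for z'
    proof -
      have z'R: "z' \<in> carrier R" using z' by auto
      have "\<iota> z' \<otimes>\<^bsub>K\<^esub> b \<in> (\<iota> ` I) \<cdot>\<^bsub>K\<^esub> B"
        using z' prod(2) by (intro ideal_prod.prod) auto
      then obtain q where q: "q \<in> carrier R" "\<iota> z' \<otimes>\<^bsub>K\<^esub> b = \<iota> q"
        unfolding IB by auto
      then have "\<iota> (z' \<otimes> y) = \<iota> (d \<otimes> q)"
        using swap[OF z'R] dR by simp
      then have "z' \<otimes> y = d \<otimes> q"
        using z'R y q dR by (intro inj) auto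
      then show ?thesis using q by blast
    qed
    then have "y \<in> colon R d I"
      using y by (simp add: colon_iff[OF dR])
    then have "z \<otimes> y \<in> I \<cdot> colon R d I"
      using z by (intro ideal_prod.prod)
    then show ?case
      using swap[OF zR] z zR bK by auto
  next
    case (sum x1 x2)
    then obtain v1 v2 where v: "v1 \<in> I \<cdot> colon R d I" "v2 \<in> I \<cdot> colon R d I"
      "\<iota> d \<otimes>\<^bsub>K\<^esub> x1 = \<iota> v1" "\<iota> d \<otimes>\<^bsub>K\<^esub> x2 = \<iota> v2" by blast
    have "v1 \<in> carrier R" "v2 \<in> carrier R"
      using v ideal_prod_in_carrier[OF I ideal_colon[OF dR]] I.Icarr by blast+
    then have "\<iota> d \<otimes>\<^bsub>K\<^esub> (x1 \<oplus>\<^bsub>K\<^esub> x2) = \<iota> (v1 \<oplus> v2)"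
      using sum v dR by (simp add: \<iota>.S.r_distr)
    moreover have "v1 \<oplus> v2 \<in> I \<cdot> colon R d I"
      using v(1,2) by (rule ideal_prod.sum)
    moreover have "x1 \<oplus>\<^bsub>K\<^esub> x2 \<in> carrier K"
      using sum by blast
    ultimately show ?case
      by blast
  qed
  \<comment> \<open>The identity belongs to the product of \<open>I\<close> with its inverse, so the
    claim applies to \<open>d\<close> times the identity, that is, to \<open>d\<close>.\<close>
  moreover have "\<one>\<^bsub>K\<^esub> \<in> (\<iota> ` I) \<cdot>\<^bsub>K\<^esub> B"
    unfolding IB using \<iota>.hom_one by (metis image_eqI one_closed)
  ultimately obtain v where v: "v \<in> I \<cdot> colon R d I" "\<iota> d \<otimes>\<^bsub>K\<^esub> \<one>\<^bsub>K\<^esub> = \<iota> v"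
    by blast
  have "v \<in> carrier R"
    using v ideal_prod_in_carrier[OF I ideal_colon[OF dR]] I.Icarr by blast
  then have "d = v"
    using v dR by (intro inj) auto
  then show ?thesis
    using v d by blast
qed

text \<open>A principal ideal has the same annihilator as its generator. This translates the
  faithful ideals in the definitions of the two \<open>almost\<close> notions into regular
  elements.\<close>

lemma (in cring) faithful_PIdl_iff:
  assumes s: "s \<in> carrier R"
  shows "faithful R (PIdl s) \<longleftrightarrow> s \<in> regular_elements R"
proof -
  have "annihilator R (PIdl s) = {x \<in> carrier R. s \<otimes> x = \<zero>}"
  proof (intro equalityI subsetI)
    fix x assume "x \<in> annihilator R (PIdl s)"
    then show "x \<in> {x \<in> carrier R. s \<otimes> x = \<zero>}"
      using cgenideal_self[OF s] s by (auto simp: annihilator_def m_comm)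
  next
    fix x assume x: "x \<in> {x \<in> carrier R. s \<otimes> x = \<zero>}"
    have "x \<otimes> (r \<otimes> s) = \<zero>" if "r \<in> carrier R" for r
    proof -
      have "x \<otimes> (r \<otimes> s) = r \<otimes> (s \<otimes> x)"
        using that x s by (simp add: m_ac)
      then show ?thesis
        using that x by simp
    qed
    then show "x \<in> annihilator R (PIdl s)"
      using x by (auto simp: annihilator_def cgenideal_def)
  qed
  then show ?thesis
    using s unfolding faithful_def regular_elements_def by auto
qed

lemma (in cring) almost_local_global_Quot:
  assumes "almost_local_global R" "s \<in> regular_elements R"
  shows "local_global (R Quot (PIdl s))"
proof -
  have s: "s \<in> carrier R"
    using assms(2) by (rule regular_elements_carrier)
  with assms(2) have "faithful R (PIdl s)"
    by (simp add: faithful_PIdl_iff)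
  with assms(1) cgenideal_is_principalideal[OF s] show ?thesis
    unfolding almost_local_global_def by blast
qed

section \<open>Isomorphisms of quotient modules\<close>

text \<open>Multiplication by \<open>r\<close> maps \<open>I\<close> into itself, so all cosets in
  the union coincide. This evaluates scalar multiplication in \<open>quot_module\<close>.\<close>

lemma (in ideal) Union_smult_coset:
  assumes r: "r \<in> carrier R" and z: "z \<in> carrier R"
  shows "(\<Union>x\<in>I +> z. I +> (r \<otimes> x)) = I +> (r \<otimes> z)"
proof -
  have "I +> (r \<otimes> x) = I +> (r \<otimes> z)" if "x \<in> I +> z" for x
  proof -
    from that obtain n where n: "n \<in> I" "x = n \<oplus> z"
      unfolding a_r_coset_def' by auto
    then have "r \<otimes> x = r \<otimes> n \<oplus> r \<otimes> z"
      using r z Icarr by (simp add: r_distr)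
    moreover have "r \<otimes> n \<oplus> r \<otimes> z \<in> I +> (r \<otimes> z)"
      using n r z I_l_closed a_subset by (intro a_rcosI) auto
    ultimately show ?thesis
      using r z by (intro a_repr_independence'[symmetric]) auto
  qed
  moreover have "z \<in> I +> z"
    using z by (rule a_rcos_self)
  ultimately show ?thesis by blast
qed

text \<open>The linear map \<open>\<phi>\<close> followed by reduction modulo \<open>J\<close> is
  onto and has kernel \<open>N\<close>, so the first isomorphism theorem applies.\<close>

lemma (in cring) quot_module_isomorphic:
  assumes I: "ideal I R" and J: "ideal J R" and N: "ideal N R" "N \<subseteq> I"
    and \<phi>: "\<And>z. z \<in> I \<Longrightarrow> \<phi> z \<in> carrier R"
    and add: "\<And>z z'. z \<in> I \<Longrightarrow> z' \<in> I \<Longrightarrow> \<phi> (z \<oplus> z') = \<phi> z \<oplus> \<phi> z'"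
    and smult: "\<And>r z. r \<in> carrier R \<Longrightarrow> z \<in> I \<Longrightarrow> \<phi> (r \<otimes> z) = r \<otimes> \<phi> z"
    and ker: "\<And>z. z \<in> I \<Longrightarrow> \<phi> z \<in> J \<longleftrightarrow> z \<in> N"
    and surj: "\<And>u. u \<in> carrier R \<Longrightarrow> \<exists>z\<in>I. u \<ominus> \<phi> z \<in> J"
  shows "mod_isomorphic R (quot_module (ideal_module R I) N) (quot_module (ring_module R) J)"
proof -
  interpret I: ideal I R by (rule I)
  interpret J: ideal J R by (rule J)
  interpret N: ideal N R by (rule N)
  let ?M = "quot_module (ideal_module R I) N" and ?Q = "quot_module (ring_module R) J"
  \<comment> \<open>Cosets and their sums depend only on the addition, so those of the module
    records are those of \<open>R\<close>.\<close>
  have carrier_M: "carrier ?M = (+>) N ` I"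
    by (auto simp: quot_module_def ideal_module_def ring_module_def A_RCOSETS_def RCOSETS_def
        a_r_coset_def r_coset_def)
  have carrier_Q: "carrier ?Q = (+>) J ` carrier R"
    by (auto simp: quot_module_def ring_module_def A_RCOSETS_def RCOSETS_def
        a_r_coset_def r_coset_def)
  have add_M: "U \<oplus>\<^bsub>?M\<^esub> V = U <+> V" for U V
    by (simp add: quot_module_def ideal_module_def ring_module_def set_add_def set_mult_def)
  have add_Q: "U \<oplus>\<^bsub>?Q\<^esub> V = U <+> V" for U V
    by (simp add: quot_module_def ring_module_def set_add_def set_mult_def)
  have smult_M: "r \<odot>\<^bsub>?M\<^esub> U = (\<Union>x\<in>U. N +> (r \<otimes> x))" for r U
    by (simp add: quot_module_def ideal_module_def ring_module_def a_r_coset_def r_coset_def)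
  have smult_Q: "r \<odot>\<^bsub>?Q\<^esub> U = (\<Union>x\<in>U. J +> (r \<otimes> x))" for r U
    by (simp add: quot_module_def ring_module_def a_r_coset_def r_coset_def)
  \<comment> \<open>The induced map, written without choosing a representative: on a coset of
    \<open>N\<close> all members of the union are equal.\<close>
  define H where "H U = (\<Union>x\<in>U. J +> \<phi> x)" for U
  have H: "H (N +> z) = J +> \<phi> z" if z: "z \<in> I" for z
  proof -
    have "J +> \<phi> x = J +> \<phi> z" if "x \<in> N +> z" for x
    proof -
      from that obtain n where n: "n \<in> N" "x = n \<oplus> z"
        unfolding a_r_coset_def' by auto
      then have nI: "n \<in> I" using N by auto
      then have "\<phi> n \<in> J" using ker n by simp
      then have "\<phi> n \<oplus> \<phi> z \<in> J +> \<phi> z"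
        using J.a_subset \<phi>[OF z] by (intro a_rcosI) auto
      then show ?thesis
        using add[OF nI z] n \<phi>[OF z] by (intro J.a_repr_independence'[symmetric]) auto
    qed
    moreover have "z \<in> N +> z"
      using z by (intro N.a_rcos_self) auto
    ultimately show ?thesis
      unfolding H_def by blast
  qed
  have minus: "\<phi> (z \<ominus> z') = \<phi> z \<ominus> \<phi> z'" if z: "z \<in> I" "z' \<in> I" for z z'
  proof -
    have zz: "z \<ominus> z' \<in> I" using z by (simp add: minus_eq)
    have "\<phi> z = \<phi> ((z \<ominus> z') \<oplus> z')"
      using z by (simp add: minus_eq a_assoc l_neg)
    also have "\<dots> = \<phi> (z \<ominus> z') \<oplus> \<phi> z'"
      using zz z by (intro add)
    finally show ?thesis
      using \<phi>[OF zz] \<phi>[OF z(2)] by (simp add: minus_eq a_assoc r_neg)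
  qed
  have "H \<in> mod_hom R ?M ?Q"
    unfolding mod_hom_def
  proof (intro CollectI conjI ballI)
    show "H \<in> carrier ?M \<rightarrow> carrier ?Q"
      unfolding carrier_M carrier_Q using H \<phi> by auto
    fix U assume "U \<in> carrier ?M"
    then obtain z where z: "z \<in> I" "U = N +> z"
      unfolding carrier_M by auto
    {
      fix V assume "V \<in> carrier ?M"
      then obtain z' where z': "z' \<in> I" "V = N +> z'"
        unfolding carrier_M by auto
      have "U <+> V = N +> (z \<oplus> z')"
        using z z' by (simp add: N.a_rcos_sum)
      then have "H (U <+> V) = J +> (\<phi> z \<oplus> \<phi> z')"
        using z z' by (simp add: H add)
      also have "\<dots> = H U <+> H V"
        using z z' \<phi> by (simp add: H J.a_rcos_sum)
      finally show "H (U \<oplus>\<^bsub>?M\<^esub> V) = H U \<oplus>\<^bsub>?Q\<^esub> H V"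
        unfolding add_M add_Q .
    }
    fix r assume r: "r \<in> carrier R"
    have "r \<odot>\<^bsub>?M\<^esub> U = N +> (r \<otimes> z)"
      unfolding smult_M z(2) using r z(1) by (intro N.Union_smult_coset) auto
    then have "H (r \<odot>\<^bsub>?M\<^esub> U) = J +> (r \<otimes> \<phi> z)"
      using r z(1) by (simp add: H smult I.I_l_closed)
    also have "\<dots> = r \<odot>\<^bsub>?Q\<^esub> H U"
      unfolding smult_Q z(2) H[OF z(1)] using r \<phi>[OF z(1)] by (intro J.Union_smult_coset[symmetric])
    finally show "H (r \<odot>\<^bsub>?M\<^esub> U) = r \<odot>\<^bsub>?Q\<^esub> H U" .
  qed
  moreover have "inj_on H (carrier ?M)"
  proof (rule inj_onI)
    fix U V assume "U \<in> carrier ?M" "V \<in> carrier ?M" and eq: "H U = H V"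
    then obtain z z' where z: "z \<in> I" "U = N +> z" and z': "z' \<in> I" "V = N +> z'"
      unfolding carrier_M by auto
    have "J +> \<phi> z = J +> \<phi> z'"
      using eq z z' H by simp
    then have "\<phi> z \<ominus> \<phi> z' \<in> J"
      using quotient_eq_iff_same_a_r_cos[OF J] \<phi> z z' by simp
    then have "\<phi> (z \<ominus> z') \<in> J"
      using minus z z' by simp
    then have "z \<ominus> z' \<in> N"
      using ker z z' by (simp add: minus_eq)
    then show "U = V"
      using quotient_eq_iff_same_a_r_cos[OF N(1)] z z' by simp
  qed
  moreover have "H ` carrier ?M = carrier ?Q"
  proof (intro equalityI subsetI)
    fix V assume "V \<in> H ` carrier ?M"
    then show "V \<in> carrier ?Q"
      unfolding carrier_M carrier_Q using H \<phi> by auto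
  next
    fix V assume "V \<in> carrier ?Q"
    then obtain u where u: "u \<in> carrier R" "V = J +> u"
      unfolding carrier_Q by auto
    obtain z where z: "z \<in> I" "u \<ominus> \<phi> z \<in> J"
      using surj[OF u(1)] by blast
    have "J +> u = J +> \<phi> z"
      using quotient_eq_iff_same_a_r_cos[OF J u(1) \<phi>[OF z(1)]] z(2) by simp
    then have "V = H (N +> z)"
      using u H[OF z(1)] by simp
    then show "V \<in> H ` carrier ?M"
      unfolding carrier_M using z by blast
  qed
  ultimately show ?thesis
    unfolding mod_isomorphic_def bij_betw_def by blast
qed

section \<open>Almost local-global semihereditary rings\<close>

text \<open>Both sides are \<open>x y z / d\<close>.\<close>

lemma (in cring) mult_colon_cancel:
  assumes d: "d \<in> regular_elements R" and carr: "x \<in> carrier R" "y \<in> carrier R" "z \<in> carrier R"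
      "w \<in> carrier R" "q \<in> carrier R"
    and eq: "x \<otimes> y = d \<otimes> w" "z \<otimes> y = d \<otimes> q"
  shows "z \<otimes> w = x \<otimes> q"
proof (rule regular_elements_cancel[OF d])
  have dR: "d \<in> carrier R" using d by (rule regular_elements_carrier)
  have "d \<otimes> (z \<otimes> w) = z \<otimes> (d \<otimes> w)"
    using dR carr by (simp add: m_lcomm)
  also have "\<dots> = x \<otimes> (z \<otimes> y)"
    unfolding eq(1)[symmetric] using carr by (simp add: m_lcomm)
  also have "\<dots> = d \<otimes> (x \<otimes> q)"
    unfolding eq(2) using dR carr by (simp add: m_lcomm)
  finally show "d \<otimes> (z \<otimes> w) = d \<otimes> (x \<otimes> q)" .
qed (use carr in auto)

text \<open>A finitely generated ideal of the quotient is lifted to a finitely generated ideal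
  \<open>J\<close> that also contains \<open>a\<close>. As \<open>J\<close> is projective,
  \<open>local_global_colon\<close> applies with both \<open>d\<close> and \<open>s\<close> equal to
  \<open>a\<close>. It gives \<open>x\<close> with J = xR + aJ, and the image of \<open>x\<close> is
  the required generator.\<close>

lemma (in cring) almost_local_global_semihereditary_imp_almost_bezout:
  assumes semi: "semihereditary R" and alg: "almost_local_global R"
  shows "almost_bezout R"
  unfolding almost_bezout_def
proof (intro allI impI)
  fix A assume "principalideal A R" and faithful: "faithful R A"
  then obtain a where aR: "a \<in> carrier R" and A: "A = PIdl a"
    using principalideal.generate cgenideal_eq_genideal by metis
  have a: "a \<in> regular_elements R"
    using faithful faithful_PIdl_iff[OF aR] A by simp
  interpret A: ideal A R
    unfolding A by (rule cgenideal_ideal[OF aR])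
  define Q where "Q = R Quot A"
  define \<pi> where "\<pi> = (+>) A"
  interpret \<pi>: ring_hom_cring R Q \<pi>
    unfolding Q_def \<pi>_def by (rule A.rcos_ring_hom_cring[OF is_cring])
  have \<pi>_ring_hom: "ring_hom_ring R Q \<pi>"
    unfolding Q_def \<pi>_def by (rule A.rcos_ring_hom_ring)
  have carrier_Q: "carrier Q = \<pi> ` carrier R"
    unfolding Q_def \<pi>_def by (rule A.carrier_Quot)
  have "A +> a = A"
    using cgenideal_self[OF aR] unfolding A[symmetric] by (rule A.a_rcos_const)
  then have \<pi>a: "\<pi> a = \<zero>\<^bsub>Q\<^esub>"
    by (simp add: \<pi>_def Q_def FactRing_def)
  have "principalideal M Q" if M: "fg_ideal Q M" for M
  proof -
    obtain G where G: "finite G" "G \<subseteq> carrier Q" "M = Idl\<^bsub>Q\<^esub> G"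
      using M unfolding fg_ideal_def by blast
    obtain G' where G': "finite G'" "G' \<subseteq> carrier R" "G = \<pi> ` G'"
      using finite_subset_image[OF G(1) G(2)[unfolded carrier_Q]] by blast
    interpret M: ideal M Q
      unfolding G(3) by (rule \<pi>.S.genideal_ideal[OF G(2)])
    define J where "J = Idl (insert a G')"
    have gens: "insert a G' \<subseteq> carrier R"
      using aR G' by auto
    have J: "ideal J R"
      unfolding J_def by (rule genideal_ideal[OF gens])
    have gensJ: "insert a G' \<subseteq> J"
      unfolding J_def by (rule genideal_self[OF gens])
    interpret J: ideal J R by (rule J)
    have "fg_ideal R J"
      unfolding fg_ideal_def J_def using gens G'(1) by (intro exI[of _ "insert a G'"]) simp
    then have "projective_module R (ideal_module R J)"
      using semi unfolding semihereditary_def by blast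
    then have aJ: "a \<in> J \<cdot> colon R a J"
      using projective_imp_mem_prod_colon[OF J] gensJ by blast
    obtain x y w r t where x: "x \<in> J" and y: "y \<in> colon R a J"
      and wrt: "w \<in> carrier R" "r \<in> carrier R" "t \<in> carrier R"
      and xy: "x \<otimes> y = a \<otimes> w" and one: "w \<otimes> r \<oplus> a \<otimes> t = \<one>"
      using local_global_colon[OF J a aJ aR almost_local_global_Quot[OF alg a]] by blast
    have xR: "x \<in> carrier R" and yR: "y \<in> carrier R"
      using x y colon_carrier by auto
    \<comment> \<open>The generators of \<open>J\<close> map into \<open>M\<close>, the additional
      generator \<open>a\<close> because its image is zero.\<close>
    have "J \<subseteq> {z \<in> carrier R. \<pi> z \<in> M}"
      unfolding J_def
    proof (rule genideal_minimal[OF ring_hom_ring.ideal_vimage[OF \<pi>_ring_hom M.is_ideal]])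
      have "G \<subseteq> M"
        unfolding G(3) by (rule \<pi>.S.genideal_self[OF G(2)])
      then show "insert a G' \<subseteq> {z \<in> carrier R. \<pi> z \<in> M}"
        using gens G'(3) \<pi>a M.zero_closed by auto
    qed
    then have \<pi>x: "\<pi> x \<in> M"
      using x by blast
    have \<pi>xQ: "\<pi> x \<in> carrier Q"
      using xR by simp
    interpret X: ideal "Idl\<^bsub>Q\<^esub> {\<pi> x}" Q
      by (rule \<pi>.S.genideal_ideal) (use \<pi>xQ in simp)
    have "G \<subseteq> Idl\<^bsub>Q\<^esub> {\<pi> x}"
    proof
      fix g assume "g \<in> G"
      then obtain z where z: "z \<in> J" "g = \<pi> z"
        using G'(3) gensJ by auto
      have zR: "z \<in> carrier R" using z by auto
      obtain q where q: "q \<in> carrier R" "z \<otimes> y = a \<otimes> q"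
        using y z colon_iff[OF aR] by blast
      \<comment> \<open>As \<open>w\<close> is invertible modulo \<open>a\<close>, this equation
        makes \<open>z\<close> a multiple of \<open>x\<close> modulo \<open>a\<close>.\<close>
      have "z \<otimes> w = x \<otimes> q"
        by (rule mult_colon_cancel[OF a xR yR zR wrt(1) q(1) xy q(2)])
      moreover have "z = z \<otimes> (w \<otimes> r \<oplus> a \<otimes> t)"
        using zR one by simp
      moreover have "\<dots> = (z \<otimes> w) \<otimes> r \<oplus> a \<otimes> (z \<otimes> t)"
        using zR wrt aR by (simp add: r_distr m_assoc m_lcomm)
      ultimately have "z = x \<otimes> (q \<otimes> r) \<oplus> a \<otimes> (z \<otimes> t)"
        using xR q wrt by (simp add: m_assoc)
      then have "\<pi> z = \<pi> (x \<otimes> (q \<otimes> r) \<oplus> a \<otimes> (z \<otimes> t))"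
        by (rule arg_cong)
      also have "\<dots> = \<pi> x \<otimes>\<^bsub>Q\<^esub> \<pi> (q \<otimes> r)"
        using xR zR q wrt aR \<pi>a by simp
      finally show "g \<in> Idl\<^bsub>Q\<^esub> {\<pi> x}"
        using \<pi>.S.genideal_self'[OF \<pi>xQ] q wrt z(2) by (simp add: X.I_r_closed)
    qed
    then have "M \<subseteq> Idl\<^bsub>Q\<^esub> {\<pi> x}"
      unfolding G(3) by (rule \<pi>.S.genideal_minimal[OF X.is_ideal])
    moreover have "Idl\<^bsub>Q\<^esub> {\<pi> x} \<subseteq> M"
      using \<pi>x by (intro \<pi>.S.genideal_minimal[OF M.is_ideal]) simp
    ultimately show ?thesis
      using \<pi>xQ by (intro principalidealI[OF M.is_ideal]) blast
  qed
  then show "bezout (R Quot A)"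
    unfolding bezout_def Q_def by blast
qed

text \<open>Multiplication by y / d is a linear map \<open>\<phi>\<close> from \<open>I\<close> to
  \<open>R\<close> that sends \<open>x\<close> to \<open>w\<close>. Since \<open>w\<close> is a unit
  modulo \<open>s\<close> and \<open>s\<close> lies in \<open>J\<close>, reduction modulo
  \<open>J\<close> makes it onto, with kernel \<open>J \<cdot> I\<close>.\<close>

lemma (in cring) almost_local_global_invertible_quotient:
  assumes alg: "almost_local_global R" and "invertible_ideal R I" "invertible_ideal R J"
  shows "mod_isomorphic R (quot_module (ideal_module R I) (J \<cdot> I)) (quot_module (ring_module R) J)"
proof -
  have I: "ideal I R" and J: "ideal J R"
    using assms by (simp_all add: invertible_ideal_def)
  interpret I: ideal I R by (rule I)
  interpret J: ideal J R by (rule J)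
  obtain d where d: "d \<in> regular_elements R" "d \<in> I \<cdot> colon R d I"
    using invertible_ideal_regular[OF assms(2)] by blast
  note dR = regular_elements_carrier[OF d(1)]
  obtain s where s: "s \<in> regular_elements R" "s \<in> J \<cdot> colon R s J"
    using invertible_ideal_regular[OF assms(3)] by blast
  note sR = regular_elements_carrier[OF s(1)]
  have "ideal (colon R s J) R"
    by (rule ideal_colon[OF sR]) auto
  \<comment> \<open>A product of ideals lies in each factor, so invertibility supplies a regular
    element of \<open>J\<close>.\<close>
  then have sJ: "s \<in> J"
    using ideal_prod_inter[OF J] s(2) by blast
  obtain x y w r t where x: "x \<in> I" and y: "y \<in> colon R d I"
    and wrt: "w \<in> carrier R" "r \<in> carrier R" "t \<in> carrier R"
    and xy: "x \<otimes> y = d \<otimes> w" and one: "w \<otimes> r \<oplus> s \<otimes> t = \<one>"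
    using local_global_colon[OF I d sR almost_local_global_Quot[OF alg s(1)]] by blast
  have xR: "x \<in> carrier R" and yR: "y \<in> carrier R"
    using x y colon_carrier by auto
  have "\<exists>q\<in>carrier R. z \<otimes> y = d \<otimes> q" if "z \<in> I" for z
    using y that colon_iff[OF dR] by blast
  then obtain \<phi> where \<phi>: "\<And>z. z \<in> I \<Longrightarrow> \<phi> z \<in> carrier R" and zy: "\<And>z. z \<in> I \<Longrightarrow> z \<otimes> y = d \<otimes> \<phi> z"
    by metis
  \<comment> \<open>Cancelling \<open>d\<close> shows that the equation
    \<open>z \<otimes> y = d \<otimes> q\<close> determines \<open>q\<close>; linearity of
    \<open>\<phi>\<close> follows by checking such equations.\<close>
  have \<phi>_eq: "\<phi> z = q" if "z \<in> I" "q \<in> carrier R" "z \<otimes> y = d \<otimes> q" for z q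
    using regular_elements_cancel[OF d(1) \<phi>[OF that(1)] that(2)] zy[OF that(1)] that(3) by simp
  have add: "\<phi> (z \<oplus> z') = \<phi> z \<oplus> \<phi> z'" if z: "z \<in> I" "z' \<in> I" for z z'
  proof (rule \<phi>_eq)
    have "(z \<oplus> z') \<otimes> y = z \<otimes> y \<oplus> z' \<otimes> y"
      using z yR by (simp add: l_distr)
    also have "\<dots> = d \<otimes> (\<phi> z \<oplus> \<phi> z')"
      unfolding zy[OF z(1)] zy[OF z(2)] using \<phi>[OF z(1)] \<phi>[OF z(2)] dR by (simp add: r_distr)
    finally show "(z \<oplus> z') \<otimes> y = d \<otimes> (\<phi> z \<oplus> \<phi> z')" .
  qed (use z \<phi> in auto)
  have smult: "\<phi> (u \<otimes> z) = u \<otimes> \<phi> z" if z: "u \<in> carrier R" "z \<in> I" for u z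
  proof (rule \<phi>_eq)
    have "u \<otimes> z \<otimes> y = u \<otimes> (z \<otimes> y)"
      using z yR by (simp add: m_assoc)
    also have "\<dots> = d \<otimes> (u \<otimes> \<phi> z)"
      unfolding zy[OF z(2)] using z \<phi>[OF z(2)] dR by (simp add: m_lcomm)
    finally show "u \<otimes> z \<otimes> y = d \<otimes> (u \<otimes> \<phi> z)" .
  qed (use z \<phi> I.I_l_closed in auto)
  have \<phi>x: "\<phi> x = w"
    using x wrt xy by (intro \<phi>_eq)
  have JI: "ideal (J \<cdot> I) R"
    by (rule ideal_prod_is_ideal[OF J I])
  interpret JI: ideal "J \<cdot> I" R by (rule JI)
  have ker: "\<phi> z \<in> J \<longleftrightarrow> z \<in> J \<cdot> I" if z: "z \<in> I" for z
  proof
    assume "z \<in> J \<cdot> I"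
    then have "z \<in> I \<and> \<phi> z \<in> J"
    proof (induction rule: ideal_prod.induct)
      case (prod j i)
      then show ?case
        using smult[of j i] \<phi>[of i] I.I_l_closed J.I_r_closed by simp
    next
      case (sum z1 z2)
      then show ?case
        using add by simp
    qed
    then show "\<phi> z \<in> J" ..
  next
    assume \<phi>z: "\<phi> z \<in> J"
    have zR: "z \<in> carrier R" using z by auto
    \<comment> \<open>Expanding \<open>z\<close> by the relation for \<open>\<one>\<close> leaves
      two terms, one with factors \<open>\<phi> z\<close> in \<open>J\<close> and \<open>x\<close>
      in \<open>I\<close>, the other with factors \<open>s\<close> in \<open>J\<close> and
      \<open>z\<close> in \<open>I\<close>.\<close>
    have "z \<otimes> w = x \<otimes> \<phi> z"
      by (rule mult_colon_cancel[OF d(1) xR yR zR wrt(1) \<phi>[OF z] xy zy[OF z]])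
    moreover have "z = z \<otimes> (w \<otimes> r \<oplus> s \<otimes> t)"
      using zR one by simp
    moreover have "\<dots> = (z \<otimes> w) \<otimes> r \<oplus> (s \<otimes> z) \<otimes> t"
      using zR wrt sR by (simp add: r_distr m_ac)
    ultimately have "z = (\<phi> z \<otimes> x) \<otimes> r \<oplus> (s \<otimes> z) \<otimes> t"
      using xR \<phi>[OF z] by (simp add: m_comm)
    also have "\<dots> \<in> J \<cdot> I"
      using ideal_prod.prod[OF \<phi>z x, of R] ideal_prod.prod[OF sJ z, of R] wrt
      by (simp add: JI.I_r_closed)
    finally show "z \<in> J \<cdot> I" .
  qed
  have surj: "\<exists>z\<in>I. u \<ominus> \<phi> z \<in> J" if u: "u \<in> carrier R" for u
  proof
    \<comment> \<open>The preimage is chosen because \<open>\<phi>\<close> sends \<open>x\<close> to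
      \<open>w\<close> and \<open>w \<otimes> r\<close> is \<open>\<one>\<close> modulo
      \<open>s\<close>.\<close>
    show z: "(u \<otimes> r) \<otimes> x \<in> I"
      using u wrt x by (intro I.I_l_closed) auto
    have "u = u \<otimes> (w \<otimes> r \<oplus> s \<otimes> t)"
      using u one by simp
    also have "\<dots> = s \<otimes> (u \<otimes> t) \<oplus> (u \<otimes> r) \<otimes> w"
      using u wrt sR by (simp add: r_distr m_ac a_comm)
    finally have "u \<ominus> (u \<otimes> r) \<otimes> w = s \<otimes> (u \<otimes> t) \<oplus> (u \<otimes> r) \<otimes> w \<ominus> (u \<otimes> r) \<otimes> w"
      by (rule arg_cong)
    also have "\<dots> = s \<otimes> (u \<otimes> t)"
      using u wrt sR by (simp add: minus_eq a_assoc r_neg)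
    also have "\<dots> \<in> J"
      using u wrt sJ by (intro J.I_r_closed) auto
    finally show "u \<ominus> \<phi> ((u \<otimes> r) \<otimes> x) \<in> J"
      using smult[of "u \<otimes> r" x] x u wrt \<phi>x by simp
  qed
  show ?thesis
    using ideal_prod_inter[OF J I]
    by (intro quot_module_isomorphic[OF I J JI _ \<phi> add smult ker surj]) auto
qed

theorem lemma10:
  fixes R :: "('a, 'm) ring_scheme"
  assumes "cring R"
    and "semihereditary R"
    and "almost_local_global R"
  shows "almost_bezout R \<and>
    (\<forall>I J. invertible_ideal R I \<longrightarrow> invertible_ideal R J \<longrightarrow>
       mod_isomorphic R
         (quot_module (ideal_module R I) (J \<cdot>\<^bsub>R\<^esub> I))
         (quot_module (ring_module R) J))"
  using cring.almost_local_global_semihereditary_imp_almost_bezout[OF assms]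
    cring.almost_local_global_invertible_quotient[OF assms(1,3)] by blast

end
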